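(* Let $\mathcal{T}=\mathcal{T}(O)$ be a self-similar tiling in $\mathbb{R}^d$ (generated on a feasible open set $O$ of an IFS with contraction ratios $r_1,\dots,r_N$ and similarity dimension $D$) with $D>d-1$. Assume that the generator $G$, with inradius $g$, is monophase, with coefficients $\kappa_0(G),\dots,\kappa_{d-1}(G)$. Then the average Minkowski content of $\mathcal{T}$ is given by $$\widetilde{\mathcal{M}}^D(\mathcal{T})=\frac1\eta\,\frac1{d-D}\,\Gamma_D(G),\qquad \Gamma_D(G)=\sum_{k=0}^{d-1}\frac{d-k}{D-k}\,\kappa_k(G)\,g^{D-k},\qquad \eta=-\sum_{i=1}^N r_i^D\ln r_i .$$ In the nonlattice case, also the Minkowski content $\mathcal{M}^D(\mathcal{T})$ of $\mathcal{T}$ is given by the same expression.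
   Context: Setting. $N\ge2$, $S_1,\dots,S_N:\mathbb{R}^d\to\mathbb{R}^d$ are contracting similarities with ratios $r_i\in(0,1)$ (an IFS), and $\mathbf{S}(A):=\bigcup_{i=1}^N S_i(A)$. The similarity dimension $D$ is the unique real solution of $\sum_{i=1}^N r_i^D=1$. A feasible open set for the IFS is a nonempty bounded open set $O\subset\mathbb{R}^d$ with $S_iO\subset O$ for all $i$ and $S_iO\cap S_jO=\emptyset$ for $i\ne j$. The nonlattice case is the one where the additive subgroup of $\mathbb{R}$ generated by $\ln r_1,\dots,\ln r_N$ is not discrete. Tilings. Let $\Sigma_N^*=\bigcup_{n\ge0}\{1,\dots,N\}^n$, and for $\sigma=\sigma_1\cdots\sigma_n$ put $S_\sigma:=S_{\sigma_1}\circ\dots\circ S_{\sigma_n}$ (identity for the empty word). For a feasible open set $O$ let $K:=\overline O$ and let the generator be the open set $G:=O\setminus\mathbf{S}K$ (not necessarily connected). The self-similar tiling generated on $O$ is $\mathcal{T}(O):=\{S_\sigma G:\sigma\in\Sigma_N^*\}$; its union set is $T:=\bigcup_{\sigma}S_\sigma G$. The tiling is only defined when $D<d$ (equivalently $G\neq\emptyset$), which is assumed. The inradius of $G$ is $g:=\sup\{d(x,\partial G):x\in G\}$. For a bounded open set $U$, $V(U,\varepsilon):=\lambda_d(\{x\in U: d(x,\partial U)\le\varepsilon\})$, $\lambda_d$ Lebesgue measure. $G$ is monophase if there are real numbers $\kappa_k(G)$ with $V(G,\varepsilon)=\sum_{k=0}^{d-1}\kappa_k(G)\,\varepsilon^{d-k}$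 for all $0<\varepsilon\le g$. Minkowski contents of the tiling (whenever the limits exist): $\mathcal{M}^D(\mathcal{T}):=\lim_{\varepsilon\searrow0}\varepsilon^{D-d}V(T,\varepsilon)$ and $\widetilde{\mathcal{M}}^D(\mathcal{T}):=\lim_{\delta\searrow0}\frac1{|\ln\delta|}\int_\delta^1\varepsilon^{D-d}V(T,\varepsilon)\frac{d\varepsilon}{\varepsilon}$. *)

theory Defs
  imports "HOL-Analysis.Analysis" "HOL-Computational_Algebra.Group_Closure"
begin

section \<open>Iterated function systems of similarities\<close>

definition similarity_ifs ::
    "nat \<Rightarrow> (nat \<Rightarrow> real) \<Rightarrow> (nat \<Rightarrow> 'a::euclidean_space \<Rightarrow> 'a) \<Rightarrow> bool" where
  "similarity_ifs N r S \<longleftrightarrow> N \<ge> 2 \<and>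
     (\<forall>i\<in>{1..N}. 0 < r i \<and> r i < 1 \<and> (\<forall>x y. dist (S i x) (S i y) = r i * dist x y))"

definition ifs_image :: "nat \<Rightarrow> (nat \<Rightarrow> 'a \<Rightarrow> 'a) \<Rightarrow> 'a set \<Rightarrow> 'a set" where
  "ifs_image N S A = (\<Union>i\<in>{1..N}. S i ` A)"

definition similarity_dim :: "nat \<Rightarrow> (nat \<Rightarrow> real) \<Rightarrow> real" where
  "similarity_dim N r = (THE D. (\<Sum>i=1..N. r i powr D) = 1)"

lemma similarity_dim_ex1:
  fixes r :: "nat \<Rightarrow> real"
  assumes "N \<ge> 2" and r: "\<And>i. i \<in> {1..N} \<Longrightarrow> 0 < r i \<and> r i < 1"
  shows "\<exists>!D. (\<Sum>i=1..N. r i powr D) = 1"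
proof -
  define f where "f = (\<lambda>D. \<Sum>i=1..N. r i powr D)"
  have anti: "f y < f x" if "x < y" for x y
    unfolding f_def using that r assms(1)
    by (intro sum_strict_mono) (auto intro: powr_less_mono')
  have "((\<lambda>D. r i powr D) \<longlongrightarrow> 0) at_top" if "i \<in> {1..N}" for i
  proof -
    have "filterlim (\<lambda>D. ln (r i) * D) at_bot at_top"
      using r[OF that] by (intro filterlim_tendsto_neg_mult_at_bot[of _ "ln (r i)"]) (auto simp: filterlim_ident)
    then have "((\<lambda>D. exp (ln (r i) * D)) \<longlongrightarrow> 0) at_top"
      by (rule filterlim_compose[OF exp_at_bot])
    then show ?thesis
      using r[OF that] by (simp add: powr_def mult.commute)
  qed
  then have "(f \<longlongrightarrow> (\<Sum>i=1..N. 0)) at_top"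
    unfolding f_def by (intro tendsto_sum)
  then have "\<forall>\<^sub>F D in at_top. f D < 1 \<and> D \<ge> 0"
    by (intro eventually_conj order_tendstoD eventually_ge_at_top) auto
  then obtain b where b: "f b < 1" "b \<ge> 0"
    using eventually_happens'[OF trivial_limit_at_top_linorder] by blast
  have "f 0 = (\<Sum>i=1..N. 1)"
    unfolding f_def
  proof (rule sum.cong)
    show "r i powr 0 = 1" if "i \<in> {1..N}" for i using r[OF that] by simp
  qed simp
  then have "1 \<le> f 0" using assms(1) by simp
  moreover have "continuous_on {0..b} f"
    unfolding f_def using r by (intro continuous_intros) force+
  ultimately obtain D where "f D = 1"
    using IVT2'[of f b 1 0] b by auto
  moreover have "x = y" if "f x = 1" "f y = 1" for x y
    using anti[of x y] anti[of y x] that by (cases x y rule: linorder_cases) auto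
  ultimately show ?thesis unfolding f_def by blast
qed

definition feasible_open ::
    "nat \<Rightarrow> (nat \<Rightarrow> 'a::euclidean_space \<Rightarrow> 'a) \<Rightarrow> 'a set \<Rightarrow> bool" where
  "feasible_open N S U \<longleftrightarrow> U \<noteq> {} \<and> bounded U \<and> open U \<and>
     (\<forall>i\<in>{1..N}. S i ` U \<subseteq> U) \<and>
     (\<forall>i\<in>{1..N}. \<forall>j\<in>{1..N}. i \<noteq> j \<longrightarrow> S i ` U \<inter> S j ` U = {})"

definition nonlattice :: "nat \<Rightarrow> (nat \<Rightarrow> real) \<Rightarrow> bool" where
  "nonlattice N r \<longleftrightarrow> \<not> discrete (group_closure ((\<lambda>i. ln (r i)) ` {1..N}))"

section \<open>Self-similar tilings\<close>

definition word_map :: "(nat \<Rightarrow> 'a \<Rightarrow> 'a) \<Rightarrow> nat list \<Rightarrow> 'a \<Rightarrow> 'a" where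
  "word_map S w = foldr (\<lambda>i f. S i \<circ> f) w id"

definition tiling_generator ::
    "nat \<Rightarrow> (nat \<Rightarrow> 'a::euclidean_space \<Rightarrow> 'a) \<Rightarrow> 'a set \<Rightarrow> 'a set" where
  "tiling_generator N S U = U - ifs_image N S (closure U)"

definition tiling ::
    "nat \<Rightarrow> (nat \<Rightarrow> 'a::euclidean_space \<Rightarrow> 'a) \<Rightarrow> 'a set \<Rightarrow> 'a set set" where
  "tiling N S U = {word_map S w ` tiling_generator N S U | w. set w \<subseteq> {1..N}}"

section \<open>Inner parallel volumes and Minkowski contents\<close>

text \<open>Only used for nonempty bounded open sets, whose frontier is nonempty, so that the
  convention \<open>infdist x {} = 0\<close> plays no role.\<close>

definition inradius :: "'a::euclidean_space set \<Rightarrow> real" where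
  "inradius G = (SUP x\<in>G. infdist x (frontier G))"

definition inner_parallel_volume :: "'a::euclidean_space set \<Rightarrow> real \<Rightarrow> real" where
  "inner_parallel_volume U \<epsilon> = measure lebesgue {x\<in>U. infdist x (frontier U) \<le> \<epsilon>}"

text \<open>The set \<open>G\<close> is monophase with coefficients \<open>\<kappa> 0, \<dots>, \<kappa> (d - 1)\<close>;
  values of \<open>\<kappa>\<close> at larger indices are irrelevant.\<close>

definition monophase_with :: "'a::euclidean_space set \<Rightarrow> (nat \<Rightarrow> real) \<Rightarrow> bool" where
  "monophase_with G \<kappa> \<longleftrightarrow>
     (\<forall>\<epsilon>. 0 < \<epsilon> \<and> \<epsilon> \<le> inradius G \<longrightarrow>
        inner_parallel_volume G \<epsilon> = (\<Sum>k<DIM('a). \<kappa> k * \<epsilon> ^ (DIM('a) - k)))"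

text \<open>The contents of a tiling are those of its union set, relative to the
  inside of that set. They are predicates, so that they include existence of the limit.\<close>

definition has_minkowski_content ::
    "real \<Rightarrow> 'a::euclidean_space set set \<Rightarrow> real \<Rightarrow> bool" where
  "has_minkowski_content D \<T> M \<longleftrightarrow>
     ((\<lambda>\<epsilon>. \<epsilon> powr (D - real DIM('a)) * inner_parallel_volume (\<Union>\<T>) \<epsilon>) \<longlongrightarrow> M) (at_right 0)"

definition has_average_minkowski_content ::
    "real \<Rightarrow> 'a::euclidean_space set set \<Rightarrow> real \<Rightarrow> bool" where
  "has_average_minkowski_content D \<T> M \<longleftrightarrow>
     ((\<lambda>\<delta>. 1 / \<bar>ln \<delta>\<bar> *
        (LBINT \<epsilon>:{\<delta>..1}. \<epsilon> powr (D - real DIM('a)) * inner_parallel_volume (\<Union>\<T>) \<epsilon> / \<epsilon>))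
      \<longlongrightarrow> M) (at_right 0)"

end

theory Submission
  imports Defs
begin

text \<open>
  Write \<open>v \<epsilon>\<close> for the inner parallel volume of the union set \<open>T\<close> and \<open>c = d - D > 0\<close>. The set
  \<open>T\<close> is the disjoint union of the open sets \<open>G\<close>, \<open>S\<^sub>1 T\<close>, \<open>\<dots>\<close>, \<open>S\<^sub>N T\<close>. The inner distance to the
  frontier is computed inside each open piece separately, and a similarity of ratio \<open>\<rho>\<close>
  multiplies volumes by \<open>\<rho>\<^sup>d\<close> (\<open>similarity_measure_open_image\<close>), so
  \<open>v \<epsilon> = inner_parallel_volume G \<epsilon> + (\<Sum>i. r i ^ d * v (\<epsilon> / r i))\<close>
  (\<open>inner_parallel_volume_T\<close>). In terms of \<open>Z t = \<epsilon> powr (- c) * v \<epsilon>\<close> with \<open>\<epsilon> = exp (- t)\<close> this is a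
  renewal equation \<open>Z t = h t + (\<Sum>i. p i * Z (t - a i))\<close> with the probabilities \<open>p i = r i powr D\<close>
  and the steps \<open>a i = - ln (r i)\<close>, whose mean is \<open>\<eta>\<close>. Finitely many steps and a monotone \<open>v\<close>
  make an elementary proof of the renewal theorem possible.

  Let \<open>W t\<close> be the integral of \<open>Z\<close> from minus infinity to \<open>t\<close>. Integrating the renewal equation
  gives \<open>(\<Sum>i. p i * (W t - W (t - a i))) = \<integral>\<^bsub>-\<infinity>\<^esub>\<^bsup>t\<^esup> h\<close>, which tends to \<open>J = \<integral> h\<close>. This
  conserved quantity alone forces \<open>W t / t\<close> to tend to \<open>J / \<eta>\<close> (\<open>renewal_average\<close>). In the
  nonlattice case let \<open>\<beta>\<close> be the upper limit of \<open>Z\<close>, attained along times \<open>X n\<close>. As \<open>Z\<close> is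
  asymptotically an average of its own earlier values, \<open>Z (X n - s)\<close> also tends to \<open>\<beta>\<close> for every
  \<open>s\<close> in the additive monoid generated by the steps. That monoid becomes arbitrarily dense far
  out, and \<open>Z\<close> grows slowly because \<open>v\<close> is monotone; so \<open>Z\<close> is close to \<open>\<beta>\<close> on long intervals, and
  the conserved quantity there is close to \<open>\<eta> * \<beta>\<close>. Hence \<open>\<beta> = J / \<eta>\<close>, and the same argument
  applies to the lower limit (\<open>renewal_nonlattice\<close>).

  For a monophase generator \<open>h\<close> is explicit: the polynomial gives \<open>\<kappa>\<^sub>k * g powr (D - k) / (D - k)\<close>,
  and the constant value of the volume beyond the inradius gives
  \<open>\<kappa>\<^sub>k * g powr (D - k) / (d - D)\<close>. The sum over \<open>k\<close> of both terms is \<open>\<Gamma> / (d - D)\<close>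
  (\<open>tendsto_tail_integral_monophase\<close>).
\<close>

section \<open>The additive monoid generated by a set of reals\<close>

inductive_set add_monoid_closure :: "real set \<Rightarrow> real set" for A where
  zero: "0 \<in> add_monoid_closure A"
| step: "s \<in> add_monoid_closure A \<Longrightarrow> a \<in> A \<Longrightarrow> s + a \<in> add_monoid_closure A"

lemma add_monoid_closure_add:
  assumes "s \<in> add_monoid_closure A" "t \<in> add_monoid_closure A"
  shows "s + t \<in> add_monoid_closure A"
  using assms(2,1)
  by (induction) (auto intro: add_monoid_closure.step simp flip: add.assoc)

lemma add_monoid_closure_of_nat_mult:
  assumes "s \<in> add_monoid_closure A"
  shows "of_nat n * s \<in> add_monoid_closure A"
  using assms
  by (induction n) (auto simp: algebra_simps intro: add_monoid_closure_add add_monoid_closure.zero)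

lemma group_closure_diff_add_monoid_closure:
  assumes "x \<in> group_closure A"
  shows "\<exists>s\<in>add_monoid_closure A. \<exists>s'\<in>add_monoid_closure A. x = s - s'"
  using assms
proof induction
  case (base s)
  then show ?case
    using add_monoid_closure.step[OF add_monoid_closure.zero, of s A] add_monoid_closure.zero[of A]
    by force
next
  case (diff s t)
  then obtain u u' v v' where
    "u \<in> add_monoid_closure A" "u' \<in> add_monoid_closure A" "s = u - u'"
    "v \<in> add_monoid_closure A" "v' \<in> add_monoid_closure A" "t = v - v'"
    by blast
  then have "u + v' \<in> add_monoid_closure A" "u' + v \<in> add_monoid_closure A" "s - t = (u + v') - (u' + v)"
    by (auto intro: add_monoid_closure_add)
  then show ?case by blast
qed

lemma group_closure_uminus_image:
  "group_closure (uminus ` A) = group_closure (A :: real set)"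
proof -
  have sub: "group_closure (uminus ` B) \<subseteq> group_closure B" for B :: "real set"
  proof
    fix x assume "x \<in> group_closure (uminus ` B)"
    then show "x \<in> group_closure B"
      by induction (auto intro: group_closure.intros)
  qed
  from sub[of A] sub[of "uminus ` A"] show ?thesis
    by (auto simp: image_image)
qed

text \<open>
  A nondiscrete group contains some \<open>\<gamma>\<close> with \<open>0 < \<gamma> < \<delta>\<close>, and \<open>\<gamma> = s - s'\<close> with \<open>s\<close>, \<open>s'\<close> in the
  monoid. The elements \<open>k * s + (m - k) * s' = m * s' + k * \<gamma>\<close> with \<open>k \<le> m\<close> form a progression of
  mesh \<open>\<gamma>\<close> that starts at \<open>m * s'\<close>; once \<open>m * \<gamma> \<ge> s'\<close>, it reaches the start of the next one.
\<close>

lemma add_monoid_closure_asymptotically_dense: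
  assumes pos: "\<And>a. a \<in> A \<Longrightarrow> 0 < a" and "A \<noteq> {}"
    and nd: "\<not> discrete (group_closure A)" and "0 < \<delta>"
  obtains L where "\<And>x. x \<ge> L \<Longrightarrow> \<exists>s\<in>add_monoid_closure A. x - \<delta> < s \<and> s \<le> x"
proof -
  obtain x y where xy: "x \<in> group_closure A" "y \<in> group_closure A" "dist x y < \<delta>" "y \<noteq> x"
    using nd \<open>0 < \<delta>\<close> unfolding discrete_def isolated_in_dist_Ex_iff by blast
  define \<gamma> where "\<gamma> = \<bar>x - y\<bar>"
  have \<gamma>: "0 < \<gamma>" "\<gamma> < \<delta>" "\<gamma> \<in> group_closure A"
    using xy group_closure.diff[of x A y] group_closure.diff[of y A x]
    by (auto simp: \<gamma>_def dist_real_def abs_if)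
  obtain a where a: "a \<in> A" using \<open>A \<noteq> {}\<close> by blast
  obtain s0 s1 where s01: "s0 \<in> add_monoid_closure A" "s1 \<in> add_monoid_closure A" "\<gamma> = s0 - s1"
    using group_closure_diff_add_monoid_closure[OF \<gamma>(3)] by blast
  have nn: "0 \<le> s" if "s \<in> add_monoid_closure A" for s
    using that by induction (auto dest: pos)
  \<comment> \<open>adding a generator makes \<open>s'\<close> positive without changing the difference\<close>
  define s s' where "s = s0 + a" and "s' = s1 + a"
  have s: "s \<in> add_monoid_closure A" "s' \<in> add_monoid_closure A" "s = s' + \<gamma>" "0 < s'"
    using s01 a pos[OF a] nn[OF s01(2)] by (auto simp: s_def s'_def intro: add_monoid_closure.step)
  define n where "n = nat \<lceil>s' / \<gamma>\<rceil>"
  have n: "s' / \<gamma> \<le> n" unfolding n_def by linarith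
  show thesis
  proof (rule that[of "n * s'"])
    fix x assume x: "real n * s' \<le> x"
    define m where "m = nat \<lfloor>x / s'\<rfloor>"
    have "0 \<le> x" using x \<open>0 < s'\<close> by (smt (verit) mult_nonneg_nonneg of_nat_0_le_iff)
    have "real n \<le> x / s'" using x \<open>0 < s'\<close> by (simp add: field_simps)
    then have nm: "n \<le> m" unfolding m_def by linarith
    have m: "real m \<le> x / s'" "x / s' < real m + 1"
      unfolding m_def using \<open>0 \<le> x\<close> \<open>0 < s'\<close>
      by (simp_all add: of_nat_nat)
    define y where "y = x - m * s'"
    have y: "0 \<le> y" "y < s'" using m \<open>0 < s'\<close> by (simp_all add: y_def field_simps)
    define k where "k = nat \<lfloor>y / \<gamma>\<rfloor>"
    have k: "real k \<le> y / \<gamma>" "y / \<gamma> < real k + 1"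
      unfolding k_def using y \<gamma> by (simp_all add: of_nat_nat)
    have "y / \<gamma> < s' / \<gamma>" using y \<gamma> by (simp add: divide_strict_right_mono)
    then have "k \<le> m" using k n nm by linarith
    define z where "z = real k * s + real (m - k) * s'"
    have "z \<in> add_monoid_closure A"
      unfolding z_def using s by (intro add_monoid_closure_add add_monoid_closure_of_nat_mult)
    moreover have "z = m * s' + k * \<gamma>"
      using \<open>k \<le> m\<close> by (simp add: z_def s(3) of_nat_diff algebra_simps)
    moreover have "k * \<gamma> \<le> y" "y < k * \<gamma> + \<gamma>"
      using k \<gamma> by (simp_all add: field_simps)
    ultimately show "\<exists>s\<in>add_monoid_closure A. x - \<delta> < s \<and> s \<le> x"
      using \<gamma> by (intro bexI[of _ z]) (auto simp: y_def)
  qed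
qed

section \<open>The renewal theorem for finitely many steps\<close>

text \<open>
  This is the upper limit of a bounded real function at infinity, in the form in which the renewal
  argument uses it: as a limit along a sequence and as an asymptotic upper bound.
\<close>

lemma limsup_attained_along_sequence:
  fixes f :: "real \<Rightarrow> real"
  assumes up: "\<forall>\<^sub>F t in at_top. f t \<le> B" and low: "\<forall>\<^sub>F t in at_top. b \<le> f t"
  obtains \<beta> X where "filterlim X at_top sequentially" "(\<lambda>n. f (X n)) \<longlonglongrightarrow> \<beta>"
    "\<And>e. 0 < e \<Longrightarrow> \<forall>\<^sub>F t in at_top. f t < \<beta> + e"
proof -
  define Q where "Q = {u. \<forall>\<^sub>F t in at_top. f t \<le> u}"
  define \<beta> where "\<beta> = Inf Q"
  have "B \<in> Q" using up by (simp add: Q_def)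
  have Qb: "b \<le> u" if "u \<in> Q" for u
  proof -
    have "\<forall>\<^sub>F t in at_top. b \<le> f t \<and> f t \<le> u"
      using low that by (auto simp: Q_def eventually_conj_iff)
    then show ?thesis
      using eventually_happens'[OF trivial_limit_at_top_linorder] by fastforce
  qed
  then have bdd: "bdd_below Q" by (auto simp: bdd_below_def)
  have above: "\<forall>\<^sub>F t in at_top. f t < \<beta> + e" if "0 < e" for e
  proof -
    obtain u where "u \<in> Q" "u < \<beta> + e"
      using cInf_lessD[of Q "\<beta> + e"] \<open>B \<in> Q\<close> \<open>0 < e\<close> by (auto simp: \<beta>_def)
    then have "\<forall>\<^sub>F t in at_top. f t \<le> u" by (simp add: Q_def)
    then show ?thesis by eventually_elim (use \<open>u < \<beta> + e\<close> in auto)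
  qed
  have "\<exists>t \<ge> real n. \<beta> - 1 / Suc n < f t \<and> f t < \<beta> + 1 / Suc n" for n :: nat
  proof -
    have "\<not> (\<forall>\<^sub>F t in at_top. f t \<le> \<beta> - 1 / Suc n)"
    proof
      assume "\<forall>\<^sub>F t in at_top. f t \<le> \<beta> - 1 / Suc n"
      then have "\<beta> - 1 / Suc n \<in> Q" by (simp add: Q_def)
      then have "\<beta> \<le> \<beta> - 1 / Suc n" unfolding \<beta>_def using bdd by (rule cInf_lower)
      then show False by (simp add: field_simps)
    qed
    then have "\<exists>\<^sub>F t in at_top. \<beta> - 1 / Suc n < f t"
      by (simp add: frequently_def not_less)
    moreover have "\<forall>\<^sub>F t in at_top. real n \<le> t \<and> f t < \<beta> + 1 / Suc n"
      using above[of "1 / Suc n"] eventually_ge_at_top by (auto intro: eventually_conj)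
    ultimately show ?thesis
      using frequently_ex[OF frequently_eventually_conj] by blast
  qed
  then obtain X where X: "\<And>n. real n \<le> X n" "\<And>n. \<beta> - 1 / Suc n < f (X n) \<and> f (X n) < \<beta> + 1 / Suc n"
    by metis
  have "filterlim X at_top sequentially"
    using filterlim_at_top_mono[OF filterlim_real_sequentially] X(1) by (simp add: eventually_sequentially)
  moreover have "(\<lambda>n. f (X n)) \<longlonglongrightarrow> \<beta>"
  proof (rule tendsto_sandwich[of "\<lambda>n. \<beta> - 1 / Suc n" _ _ "\<lambda>n. \<beta> + 1 / Suc n"])
    have z: "(\<lambda>n. 1 / real (Suc n)) \<longlonglongrightarrow> 0"
      using LIMSEQ_Suc[OF lim_1_over_n] by simp
    show "(\<lambda>n. \<beta> - 1 / Suc n) \<longlonglongrightarrow> \<beta>" using tendsto_diff[OF tendsto_const z, of \<beta>] by simp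
    show "(\<lambda>n. \<beta> + 1 / Suc n) \<longlonglongrightarrow> \<beta>" using tendsto_add[OF tendsto_const z, of \<beta>] by simp
  qed (use X(2) less_imp_le in \<open>auto intro!: eventuallyI\<close>)
  ultimately show thesis using above that by blast
qed

locale step_distribution =
  fixes I :: "'i set" and p a :: "'i \<Rightarrow> real"
  assumes fin: "finite I" and nonempty: "I \<noteq> {}"
    and p_pos: "\<And>i. i \<in> I \<Longrightarrow> 0 < p i" and p_sum: "(\<Sum>i\<in>I. p i) = 1"
    and a_pos: "\<And>i. i \<in> I \<Longrightarrow> 0 < a i"
begin

definition mean :: real where "mean = (\<Sum>i\<in>I. p i * a i)"

lemma mean_pos: "0 < mean"
  unfolding mean_def using fin nonempty p_pos a_pos by (intro sum_pos) auto

text \<open>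
  Up to the vanishing term \<open>h\<close>, the value \<open>Z (X n)\<close> is a weighted mean of the values
  \<open>Z (X n - a i)\<close>, none of which is eventually much above \<open>\<beta>\<close>. A mean that tends to this upper
  bound forces each of its terms to do so; induction over the monoid propagates this.
\<close>

lemma limsup_spreads:
  assumes ren: "\<And>t. Z t = h t + (\<Sum>i\<in>I. p i * Z (t - a i))"
    and h: "(h \<longlongrightarrow> 0) at_top"
    and up: "\<And>e. 0 < e \<Longrightarrow> \<forall>\<^sub>F t in at_top. Z t < \<beta> + e"
    and X: "filterlim X at_top sequentially" and lim: "(\<lambda>n. Z (X n)) \<longlonglongrightarrow> \<beta>"
    and s: "s \<in> add_monoid_closure (a ` I)"
  shows "(\<lambda>n. Z (X n - s)) \<longlonglongrightarrow> \<beta>"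
  using s
proof induction
  case zero
  then show ?case using lim by simp
next
  case (step s b)
  then obtain j where j: "j \<in> I" "b = a j" by blast
  have shift: "filterlim (\<lambda>n. X n - u) at_top sequentially" for u
    using filterlim_tendsto_add_at_top[OF tendsto_const[of "-u"] X] by simp
  show ?case
  proof (rule LIMSEQ_I)
    fix e :: real assume "0 < e"
    \<comment> \<open>the errors below add up to less than \<open>4 * e'\<close>, and dividing by \<open>p j\<close> turns this into \<open>e\<close>\<close>
    define e' where "e' = p j * e / 4"
    have "p j \<le> 1"
      using p_sum member_le_sum[OF j(1), of p] fin p_pos by (auto simp: less_imp_le)
    then have "p j * e \<le> e" using \<open>0 < e\<close> by simp
    then have e': "0 < e'" "e' < e"
      using \<open>0 < e\<close> p_pos[OF j(1)] by (simp_all add: e'_def)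
    have ev: "\<forall>\<^sub>F n in sequentially. Z (X n - s - a i) < \<beta> + e'" for i
      using eventually_compose_filterlim[OF up[OF e'(1)] shift[of "s + a i"]] by (simp add: diff_diff_eq)
    have "\<forall>\<^sub>F n in sequentially. \<forall>i\<in>I. Z (X n - s - a i) < \<beta> + e'"
      using ev by (intro eventually_ball_finite fin) auto
    moreover have "\<forall>\<^sub>F n in sequentially. \<beta> - e' < Z (X n - s)"
      using order_tendstoD(1)[OF step.IH] e' by simp
    moreover have "\<forall>\<^sub>F n in sequentially. h (X n - s) < e'"
      using order_tendstoD(2)[OF filterlim_compose[OF h shift[of s]]] e' by simp
    ultimately have "\<forall>\<^sub>F n in sequentially. norm (Z (X n - (s + b)) - \<beta>) < e"
    proof eventually_elim
      case (elim n)
      have "(\<Sum>i\<in>I - {j}. p i * Z (X n - s - a i)) \<le> (\<Sum>i\<in>I - {j}. p i * (\<beta> + e'))"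
        using elim p_pos by (intro sum_mono mult_left_mono) (auto simp: less_imp_le)
      also have "\<dots> = (1 - p j) * (\<beta> + e')"
        using p_sum fin j(1) by (simp add: sum_diff1 flip: sum_distrib_right)
      finally have "\<beta> - e' < e' + (1 - p j) * (\<beta> + e') + p j * Z (X n - s - a j)"
        using elim ren[of "X n - s"] by (simp add: sum.remove[OF fin j(1)])
      then have "p j * \<beta> < p j * Z (X n - s - a j) + 3 * e' - p j * e'"
        by (simp add: algebra_simps)
      also have "\<dots> < p j * Z (X n - s - a j) + p j * e"
        using mult_pos_pos[OF p_pos[OF j(1)] e'(1)] mult_pos_pos[OF p_pos[OF j(1)] \<open>0 < e\<close>]
        unfolding e'_def by linarith
      finally have "p j * \<beta> < p j * (Z (X n - s - a j) + e)" by (simp add: algebra_simps)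
      then have "\<beta> < Z (X n - s - a j) + e" using p_pos[OF j(1)] by simp
      moreover have "Z (X n - s - a j) < \<beta> + e" using elim j e' by fastforce
      ultimately show ?case using j by (simp add: diff_diff_eq)
    qed
    then show "\<exists>no. \<forall>n\<ge>no. norm (Z (X n - (s + b)) - \<beta>) < e"
      by (simp add: eventually_sequentially)
  qed
qed

text \<open>
  The hypotheses \<open>lower\<close> and \<open>upper\<close> say that \<open>W\<close> is an antiderivative of \<open>Z\<close>, in the only form in
  which this is needed. The hypothesis \<open>slow\<close> transfers a value of \<open>Z\<close> from a point of a fine grid
  to its whole neighbourhood, up to the factor \<open>exp (2 * c * e)\<close>; for this one needs a point of the
  grid on either side. Integrating over intervals of length \<open>a i\<close> identifies the limit.
\<close>

lemma limit_along_translates: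
  assumes nonneg: "\<And>t. 0 \<le> Z t"
    and slow: "\<And>t u. 0 \<le> u \<Longrightarrow> Z (t + u) \<le> exp (c * u) * Z t"
    and "0 < c"
    and lower: "\<And>s t b. s \<le> t \<Longrightarrow> (\<And>u. s \<le> u \<Longrightarrow> u \<le> t \<Longrightarrow> b \<le> Z u) \<Longrightarrow> b * (t - s) \<le> W t - W s"
    and upper: "\<And>s t b. s \<le> t \<Longrightarrow> (\<And>u. s \<le> u \<Longrightarrow> u \<le> t \<Longrightarrow> Z u \<le> b) \<Longrightarrow> W t - W s \<le> b * (t - s)"
    and lim: "((\<lambda>t. \<Sum>i\<in>I. p i * (W t - W (t - a i))) \<longlongrightarrow> J) at_top"
    and nd: "\<not> discrete (group_closure (a ` I))"
    and X: "filterlim X at_top sequentially"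
    and trans: "\<And>s. s \<in> add_monoid_closure (a ` I) \<Longrightarrow> (\<lambda>n. Z (X n - s)) \<longlonglongrightarrow> \<beta>"
  shows "J = mean * \<beta>"
proof -
  have key: "mean * (exp (- (2 * c * e)) * (\<beta> - e)) \<le> J \<and> J \<le> mean * (exp (2 * c * e) * (\<beta> + e))"
    if "0 < e" for e
  proof -
    obtain L where L: "\<And>x. x \<ge> L \<Longrightarrow> \<exists>s\<in>add_monoid_closure (a ` I). x - e < s \<and> s \<le> x"
      using add_monoid_closure_asymptotically_dense[of "a ` I" e] a_pos nonempty nd \<open>0 < e\<close> by blast
    define amax where "amax = Max (a ` I)"
    have amax: "a i \<le> amax" if "i \<in> I" for i
      using that fin by (simp add: amax_def)
    \<comment> \<open>bounds \<open>j + 2\<close> for all cells \<open>[L + j * e, L + (j + 1) * e]\<close> that meet \<open>[L, L + amax]\<close>: the point \<open>\<sigma> (j + 2)\<close> lies beyond the \<open>j\<close>-th cell\<close>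
    define m where "m = nat \<lceil>amax / e\<rceil> + 2"
    \<comment> \<open>\<open>\<sigma> j\<close> is an element of the monoid less than \<open>e\<close> below the point \<open>L + j * e\<close>\<close>
    have "\<exists>s\<in>add_monoid_closure (a ` I). L + real j * e - e < s \<and> s \<le> L + real j * e" for j :: nat
      using L[of "L + real j * e"] \<open>0 < e\<close> by simp
    then obtain \<sigma> where \<sigma>: "\<And>j. \<sigma> j \<in> add_monoid_closure (a ` I)"
      "\<And>j. L + real j * e - e < \<sigma> j" "\<And>j. \<sigma> j \<le> L + real j * e"
      by metis
    have "\<forall>\<^sub>F n in sequentially. \<bar>Z (X n - \<sigma> j) - \<beta>\<bar> < e" for j
      using tendstoD[OF trans[OF \<sigma>(1)] \<open>0 < e\<close>] by (simp add: dist_real_def)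
    then have "\<forall>\<^sub>F n in sequentially. \<forall>j\<in>{..m}. \<bar>Z (X n - \<sigma> j) - \<beta>\<bar> < e"
      by (intro eventually_ball_finite) auto
    then have ev: "\<forall>\<^sub>F n in sequentially.
      mean * (exp (- (2 * c * e)) * (\<beta> - e)) \<le> (\<Sum>i\<in>I. p i * (W (X n - L) - W (X n - L - a i))) \<and>
      (\<Sum>i\<in>I. p i * (W (X n - L) - W (X n - L - a i))) \<le> mean * (exp (2 * c * e) * (\<beta> + e))"
    proof eventually_elim
      case (elim n)
      have Zb: "exp (- (2 * c * e)) * (\<beta> - e) \<le> Z (X n - u) \<and> Z (X n - u) \<le> exp (2 * c * e) * (\<beta> + e)"
        if u: "L \<le> u" "u \<le> L + amax" for u
      proof -
        define j where "j = nat \<lfloor>(u - L) / e\<rfloor>"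
        have j: "real j \<le> (u - L) / e" "(u - L) / e < real j + 1"
          unfolding j_def using u \<open>0 < e\<close> by (simp_all add: of_nat_nat)
        have "(u - L) / e \<le> amax / e" using u \<open>0 < e\<close> by (simp add: divide_right_mono)
        then have "j + 2 \<le> m" using j unfolding m_def by linarith
        have je: "L + real j * e \<le> u" "u < L + real j * e + e"
          using j \<open>0 < e\<close> by (simp_all add: field_simps)
        have near: "\<bar>Z (X n - \<sigma> j) - \<beta>\<bar> < e" "\<bar>Z (X n - \<sigma> (j + 2)) - \<beta>\<bar> < e"
          using elim \<open>j + 2 \<le> m\<close> by auto
        have d1: "0 \<le> u - \<sigma> j" "u - \<sigma> j \<le> 2 * e" using \<sigma>(2,3)[of j] je by linarith+
        have d2: "0 \<le> \<sigma> (j + 2) - u" "\<sigma> (j + 2) - u \<le> 2 * e"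
          using \<sigma>(2,3)[of "j + 2"] je by (simp_all add: algebra_simps)
        have "Z (X n - \<sigma> j) \<le> exp (c * (u - \<sigma> j)) * Z (X n - u)"
          using slow[OF d1(1), of "X n - u"] by simp
        also have "\<dots> \<le> exp (2 * c * e) * Z (X n - u)"
          using d1 nonneg \<open>0 < c\<close> by (intro mult_right_mono) auto
        finally have "\<beta> - e \<le> exp (2 * c * e) * Z (X n - u)" using near by linarith
        then have "exp (- (2 * c * e)) * (\<beta> - e) \<le> Z (X n - u)"
          by (simp add: exp_minus field_simps)
        moreover have "Z (X n - u) \<le> exp (c * (\<sigma> (j + 2) - u)) * Z (X n - \<sigma> (j + 2))"
          using slow[OF d2(1), of "X n - \<sigma> (j + 2)"] by simp
        then have "Z (X n - u) \<le> exp (2 * c * e) * Z (X n - \<sigma> (j + 2))"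
          using d2 nonneg[of "X n - \<sigma> (j + 2)"] \<open>0 < c\<close>
          by (elim order_trans) (intro mult_right_mono, auto)
        then have "Z (X n - u) \<le> exp (2 * c * e) * (\<beta> + e)"
          by (rule order_trans) (use near in \<open>intro mult_left_mono; simp\<close>)
        ultimately show ?thesis by blast
      qed
      have "exp (- (2 * c * e)) * (\<beta> - e) * a i \<le> W (X n - L) - W (X n - L - a i)"
        "W (X n - L) - W (X n - L - a i) \<le> exp (2 * c * e) * (\<beta> + e) * a i" if "i \<in> I" for i
      proof -
        have r: "exp (- (2 * c * e)) * (\<beta> - e) \<le> Z v \<and> Z v \<le> exp (2 * c * e) * (\<beta> + e)"
          if "X n - L - a i \<le> v" "v \<le> X n - L" for v
          using Zb[of "X n - v"] that amax[OF \<open>i \<in> I\<close>] by simp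
        show "exp (- (2 * c * e)) * (\<beta> - e) * a i \<le> W (X n - L) - W (X n - L - a i)"
          using lower[of "X n - L - a i" "X n - L" "exp (- (2 * c * e)) * (\<beta> - e)"]
            r a_pos[OF \<open>i \<in> I\<close>] by simp
        show "W (X n - L) - W (X n - L - a i) \<le> exp (2 * c * e) * (\<beta> + e) * a i"
          using upper[of "X n - L - a i" "X n - L" "exp (2 * c * e) * (\<beta> + e)"]
            r a_pos[OF \<open>i \<in> I\<close>] by simp
      qed
      note * = this
      have "(\<Sum>i\<in>I. p i * (exp (- (2 * c * e)) * (\<beta> - e) * a i))
              \<le> (\<Sum>i\<in>I. p i * (W (X n - L) - W (X n - L - a i)))"
        using * p_pos by (intro sum_mono mult_left_mono) (auto simp: less_imp_le)
      moreover have "(\<Sum>i\<in>I. p i * (W (X n - L) - W (X n - L - a i)))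
              \<le> (\<Sum>i\<in>I. p i * (exp (2 * c * e) * (\<beta> + e) * a i))"
        using * p_pos by (intro sum_mono mult_left_mono) (auto simp: less_imp_le)
      ultimately show ?case
        by (simp add: mean_def sum_distrib_right sum_distrib_left mult_ac)
    qed
    have "filterlim (\<lambda>n. X n - L) at_top sequentially"
      using filterlim_tendsto_add_at_top[OF tendsto_const[of "-L"] X] by simp
    from filterlim_compose[OF lim this]
    have "(\<lambda>n. \<Sum>i\<in>I. p i * (W (X n - L) - W (X n - L - a i))) \<longlonglongrightarrow> J" .
    from tendsto_lowerbound[OF this] tendsto_upperbound[OF this] ev show ?thesis
      by (simp add: eventually_conj_iff)
  qed
  have "((\<lambda>e. mean * (exp (- (2 * c * e)) * (\<beta> - e))) \<longlongrightarrow> mean * (exp (- (2 * c * 0)) * (\<beta> - 0))) (at_right 0)"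
    by (intro tendsto_intros)
  then have "mean * \<beta> \<le> J"
    using key by (intro tendsto_upperbound[of "\<lambda>e. mean * (exp (- (2 * c * e)) * (\<beta> - e))" _ "at_right 0"])
      (auto intro!: eventually_mono[OF eventually_at_right_less])
  moreover have "((\<lambda>e. mean * (exp (2 * c * e) * (\<beta> + e))) \<longlongrightarrow> mean * (exp (2 * c * 0) * (\<beta> + 0))) (at_right 0)"
    by (intro tendsto_intros)
  then have "J \<le> mean * \<beta>"
    using key by (intro tendsto_lowerbound[of "\<lambda>e. mean * (exp (2 * c * e) * (\<beta> + e))" _ "at_right 0"])
      (auto intro!: eventually_mono[OF eventually_at_right_less])
  ultimately show ?thesis by simp
qed

text \<open>
  Upper and lower limit of \<open>Z\<close> both equal \<open>J / mean\<close>, by \<open>limit_along_translates\<close>. The lower limit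
  is obtained as the upper limit of \<open>- Z\<close>, since the renewal equation is linear; only
  \<open>limsup_spreads\<close>, which does not ask for a sign, is applied to \<open>- Z\<close>.
\<close>

theorem renewal_nonlattice:
  assumes nonneg: "\<And>t. 0 \<le> Z t"
    and slow: "\<And>t u. 0 \<le> u \<Longrightarrow> Z (t + u) \<le> exp (c * u) * Z t"
    and "0 < c"
    and ren: "\<And>t. Z t = h t + (\<Sum>i\<in>I. p i * Z (t - a i))"
    and h: "(h \<longlongrightarrow> 0) at_top"
    and lower: "\<And>s t b. s \<le> t \<Longrightarrow> (\<And>u. s \<le> u \<Longrightarrow> u \<le> t \<Longrightarrow> b \<le> Z u) \<Longrightarrow> b * (t - s) \<le> W t - W s"
    and upper: "\<And>s t b. s \<le> t \<Longrightarrow> (\<And>u. s \<le> u \<Longrightarrow> u \<le> t \<Longrightarrow> Z u \<le> b) \<Longrightarrow> W t - W s \<le> b * (t - s)"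
    and lim: "((\<lambda>t. \<Sum>i\<in>I. p i * (W t - W (t - a i))) \<longlongrightarrow> J) at_top"
    and nd: "\<not> discrete (group_closure (a ` I))"
  shows "(Z \<longlongrightarrow> J / mean) at_top"
proof -
  obtain j where j: "j \<in> I" using nonempty by blast
  have W_mono: "W s \<le> W t" if "s \<le> t" for s t
    using lower[OF that, of 0] nonneg by simp
  \<comment> \<open>boundedness of \<open>Z\<close>: a large value would persist over the preceding step and make \<open>W t - W (t - a j)\<close> large\<close>
  define B where "B = (J + 1) * exp (c * a j) / (p j * a j)"
  have "\<forall>\<^sub>F t in at_top. (\<Sum>i\<in>I. p i * (W t - W (t - a i))) < J + 1"
    using order_tendstoD(2)[OF lim] by simp
  then have bounded: "\<forall>\<^sub>F t in at_top. Z t \<le> B"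
  proof eventually_elim
    case (elim t)
    have "exp (- (c * a j)) * Z t \<le> Z u" if "t - a j \<le> u" "u \<le> t" for u
    proof -
      have "Z t \<le> exp (c * (t - u)) * Z u" using slow[of "t - u" u] that by simp
      also have "\<dots> \<le> exp (c * a j) * Z u"
        using that nonneg \<open>0 < c\<close> by (intro mult_right_mono) auto
      finally show ?thesis by (simp add: exp_minus field_simps)
    qed
    then have "exp (- (c * a j)) * Z t * a j \<le> W t - W (t - a j)"
      using lower[of "t - a j" t "exp (- (c * a j)) * Z t"] a_pos[OF j] by simp
    then have "p j * (exp (- (c * a j)) * Z t * a j) \<le> p j * (W t - W (t - a j))"
      using p_pos[OF j] by simp
    also have "\<dots> \<le> (\<Sum>i\<in>I. p i * (W t - W (t - a i)))"
      using j fin p_pos W_mono a_pos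
      by (intro member_le_sum mult_nonneg_nonneg) (auto simp: less_imp_le)
    also have "\<dots> \<le> J + 1" using elim by simp
    finally have "Z t * (p j * a j) \<le> (J + 1) * exp (c * a j)"
      by (simp add: exp_minus field_simps)
    then show ?case
      using p_pos[OF j] a_pos[OF j] by (simp add: B_def pos_le_divide_eq)
  qed
  obtain \<beta> X where \<beta>: "filterlim X at_top sequentially" "(\<lambda>n. Z (X n)) \<longlonglongrightarrow> \<beta>"
    "\<And>e. 0 < e \<Longrightarrow> \<forall>\<^sub>F t in at_top. Z t < \<beta> + e"
    by (rule limsup_attained_along_sequence[OF bounded, of 0]) (use nonneg in simp, rule that)
  obtain \<alpha> Y where \<alpha>: "filterlim Y at_top sequentially" "(\<lambda>n. - Z (Y n)) \<longlonglongrightarrow> \<alpha>"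
    "\<And>e. 0 < e \<Longrightarrow> \<forall>\<^sub>F t in at_top. - Z t < \<alpha> + e"
  proof (rule limsup_attained_along_sequence[of "\<lambda>t. - Z t" 0 "- B"])
    show "\<forall>\<^sub>F t in at_top. - Z t \<le> 0" using nonneg by simp
    show "\<forall>\<^sub>F t in at_top. - B \<le> - Z t" using bounded by simp
  qed (rule that)
  have ren': "- Z t = - h t + (\<Sum>i\<in>I. p i * (- Z (t - a i)))" for t
    using ren[of t] by (simp add: sum_negf)
  have "J = mean * \<beta>"
    using limit_along_translates[OF nonneg slow \<open>0 < c\<close> lower upper lim nd \<beta>(1)
        limsup_spreads[OF ren h \<beta>(3) \<beta>(1,2)]] .
  moreover have translates: "(\<lambda>n. Z (Y n - s)) \<longlonglongrightarrow> - \<alpha>" if "s \<in> add_monoid_closure (a ` I)" for s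
    using tendsto_minus[OF limsup_spreads[of "\<lambda>t. - Z t" "\<lambda>t. - h t", OF ren' _ \<alpha>(3) \<alpha>(1,2) that]]
      tendsto_minus[OF h] by simp
  have "J = mean * (- \<alpha>)"
    by (rule limit_along_translates[OF nonneg slow \<open>0 < c\<close> lower upper lim nd \<alpha>(1) translates])
  ultimately have eq: "\<beta> = J / mean" "- \<alpha> = J / mean"
    using mean_pos by (metis less_irrefl nonzero_mult_div_cancel_left)+
  show ?thesis
  proof (rule tendstoI)
    fix e :: real assume "0 < e"
    from \<alpha>(3)[OF this] \<beta>(3)[OF this] show "\<forall>\<^sub>F t in at_top. dist (Z t) (J / mean) < e"
      by eventually_elim (use eq in \<open>auto simp: dist_real_def\<close>)
  qed
qed

text \<open>
  The deviation \<open>Y t = W t - J / mean * t\<close> differs from a weighted mean of its earlier values by an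
  error that tends to zero. Each step back is at least \<open>amin\<close> long, so an error below \<open>q * amin\<close>
  lets \<open>\<bar>Y\<bar>\<close> grow with slope at most \<open>q\<close>.
\<close>

theorem renewal_average:
  assumes mono: "mono W"
    and lim: "((\<lambda>t. \<Sum>i\<in>I. p i * (W t - W (t - a i))) \<longlongrightarrow> J) at_top"
  shows "((\<lambda>t. W t / t) \<longlongrightarrow> J / mean) at_top"
proof -
  define Y where "Y t = W t - J / mean * t" for t
  define amin amax where "amin = Min (a ` I)" and "amax = Max (a ` I)"
  have am: "amin \<le> a i" "a i \<le> amax" if "i \<in> I" for i
    using that fin by (simp_all add: amin_def amax_def)
  have "0 < amin" using fin nonempty a_pos by (simp add: amin_def)
  have "0 < amax" using am nonempty a_pos by (meson all_not_in_conv less_le_trans)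
  have "(\<Sum>i\<in>I. p i * (Y t - Y (t - a i))) = (\<Sum>i\<in>I. p i * (W t - W (t - a i))) - J" for t
  proof -
    have "(\<Sum>i\<in>I. p i * (Y t - Y (t - a i)))
        = (\<Sum>i\<in>I. p i * (W t - W (t - a i)) - J / mean * (p i * a i))"
      by (intro sum.cong) (simp_all add: Y_def algebra_simps diff_divide_distrib)
    also have "\<dots> = (\<Sum>i\<in>I. p i * (W t - W (t - a i))) - J / mean * mean"
      by (simp add: sum_subtractf mean_def sum_distrib_left)
    finally show ?thesis using mean_pos by simp
  qed
  then have lim0: "((\<lambda>t. \<Sum>i\<in>I. p i * (Y t - Y (t - a i))) \<longlongrightarrow> 0) at_top"
    using tendsto_diff[OF lim tendsto_const, of J] by simp
  have "\<forall>\<^sub>F t in at_top. \<bar>Y t / t\<bar> < e" if "0 < e" for e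
  proof -
    define q where "q = e / 2"
    have "0 < q" using that by (simp add: q_def)
    have "\<forall>\<^sub>F t in at_top. \<bar>\<Sum>i\<in>I. p i * (Y t - Y (t - a i))\<bar> < q * amin \<and> 0 \<le> t"
      using tendstoD[OF lim0, of "q * amin"] \<open>0 < q\<close> \<open>0 < amin\<close> eventually_ge_at_top[of 0]
      by (auto simp: dist_real_def intro: eventually_conj)
    then obtain t0 where t0: "\<And>t. t0 \<le> t \<Longrightarrow> \<bar>\<Sum>i\<in>I. p i * (Y t - Y (t - a i))\<bar> < q * amin"
      "0 \<le> t0"
      unfolding eventually_at_top_linorder by blast
    define C where "C = \<bar>W (t0 - amax)\<bar> + \<bar>W t0\<bar> + \<bar>J / mean\<bar> * (t0 + amax)"
    have base: "\<bar>Y t\<bar> \<le> C" if t: "t0 - amax \<le> t" "t \<le> t0" for t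
    proof -
      have "W (t0 - amax) \<le> W t" "W t \<le> W t0" using mono t by (auto dest: monoD)
      then have "\<bar>W t\<bar> \<le> \<bar>W (t0 - amax)\<bar> + \<bar>W t0\<bar>" by linarith
      moreover have "\<bar>J / mean * t\<bar> \<le> \<bar>J / mean\<bar> * (t0 + amax)"
        unfolding abs_mult using t \<open>0 < amax\<close> t0 by (intro mult_left_mono) auto
      ultimately show ?thesis unfolding Y_def C_def by linarith
    qed
    have step: "\<bar>Y t\<bar> \<le> C + real n * (q * amin)" if "t0 - amax \<le> t" "t \<le> t0 + real n * amin" for n t
      using that
    proof (induction n arbitrary: t)
      case 0
      then show ?case using base by simp
    next
      case (Suc n)
      show ?case
      proof (cases "t \<le> t0")
        case True
        then have "\<bar>Y t\<bar> \<le> C" using base Suc.prems by simp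
        moreover have "0 \<le> real (Suc n) * (q * amin)" using \<open>0 < q\<close> \<open>0 < amin\<close> by simp
        ultimately show ?thesis by linarith
      next
        case False
        have "\<bar>Y (t - a i)\<bar> \<le> C + real n * (q * amin)" if "i \<in> I" for i
          using Suc.IH[of "t - a i"] Suc.prems False am[OF that] by (simp add: algebra_simps)
        then have "(\<Sum>i\<in>I. p i * \<bar>Y (t - a i)\<bar>) \<le> (\<Sum>i\<in>I. p i * (C + real n * (q * amin)))"
          using p_pos by (intro sum_mono mult_left_mono) (auto simp: less_imp_le)
        also have "\<dots> = C + real n * (q * amin)" using p_sum by (simp flip: sum_distrib_right)
        finally have s: "(\<Sum>i\<in>I. p i * \<bar>Y (t - a i)\<bar>) \<le> C + real n * (q * amin)" .
        have "\<bar>\<Sum>i\<in>I. p i * Y (t - a i)\<bar> \<le> (\<Sum>i\<in>I. p i * \<bar>Y (t - a i)\<bar>)"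
          using p_pos by (intro order_trans[OF sum_abs] sum_mono) (auto simp: abs_mult less_imp_le)
        moreover have "Y t = (\<Sum>i\<in>I. p i * (Y t - Y (t - a i))) + (\<Sum>i\<in>I. p i * Y (t - a i))"
          using p_sum by (simp add: right_diff_distrib sum_subtractf flip: sum_distrib_right)
        moreover have "\<bar>\<Sum>i\<in>I. p i * (Y t - Y (t - a i))\<bar> < q * amin" using t0 False by simp
        ultimately have "\<bar>Y t\<bar> \<le> q * amin + (C + real n * (q * amin))" using s by linarith
        then show ?thesis by (simp add: algebra_simps)
      qed
    qed
    have "\<forall>\<^sub>F t in at_top. t0 < t \<and> 0 < t \<and> C + q * amin < q * t"
    proof (intro eventually_conj eventually_gt_at_top)
      show "\<forall>\<^sub>F t in at_top. C + q * amin < q * t"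
        using eventually_gt_at_top[of "(C + q * amin) / q"]
        by eventually_elim (use \<open>0 < q\<close> in \<open>simp add: field_simps\<close>)
    qed
    then show ?thesis
    proof eventually_elim
      case (elim t)
      define n where "n = nat \<lceil>(t - t0) / amin\<rceil>"
      have n: "(t - t0) / amin \<le> real n" "real n < (t - t0) / amin + 1"
        unfolding n_def using elim \<open>0 < amin\<close> by (simp_all add: of_nat_nat) linarith+
      have "real n * amin < t - t0 + amin" "t - t0 \<le> real n * amin"
        using n \<open>0 < amin\<close> by (simp_all add: field_simps)
      then have "\<bar>Y t\<bar> \<le> C + real n * (q * amin)" using step[of t n] elim \<open>0 < amax\<close> by simp
      also have "\<dots> \<le> C + q * (t - t0 + amin)"
        using \<open>real n * amin < t - t0 + amin\<close> \<open>0 < q\<close>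
        by (simp add: mult.left_commute[of "real n"] less_imp_le)
      also have "\<dots> \<le> C + q * amin + q * t" using \<open>0 < q\<close> t0(2) by (simp add: algebra_simps)
      also have "\<dots> < e * t" using elim by (simp add: q_def)
      finally show ?case using elim by (simp add: abs_mult field_simps)
    qed
  qed
  then have "((\<lambda>t. Y t / t) \<longlongrightarrow> 0) at_top" by (intro tendstoI) (simp add: dist_real_def)
  then have "((\<lambda>t. Y t / t + J / mean) \<longlongrightarrow> 0 + J / mean) at_top" by (intro tendsto_intros)
  moreover have "\<forall>\<^sub>F t in at_top. Y t / t + J / mean = W t / t"
    using eventually_gt_at_top[of 0] by eventually_elim (simp add: Y_def field_simps)
  ultimately show ?thesis by (simp add: filterlim_cong)
qed

end

section \<open>Scaling equations\<close>

text \<open>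
  The integrand is dominated by a multiple of \<open>x powr (- c - 1)\<close>, which is integrable at infinity.
\<close>

lemma set_integrable_powr_tail:
  fixes v :: "real \<Rightarrow> real"
  assumes "mono v" "\<And>x. 0 \<le> v x" "\<And>x. v x \<le> B" and "0 < c" "0 < \<delta>"
  shows "set_integrable lborel {\<delta>..} (\<lambda>x. x powr (- c) * v x / x)"
proof -
  have [measurable]: "v \<in> borel_measurable borel" using \<open>mono v\<close> by (rule borel_measurable_mono)
  have "(\<lambda>x. x powr (- c - 1)) integrable_on {\<delta>..}"
    using has_integral_powr_to_inf[of "- c - 1" \<delta>] assms(4,5) by (auto simp: has_integral_integrable)
  then have "(\<lambda>x. x powr (- c - 1)) absolutely_integrable_on {\<delta>..}"
    by (intro nonnegative_absolutely_integrable_1) auto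
  then have "set_integrable lborel {\<delta>..} (\<lambda>x. x powr (- c - 1))"
    unfolding set_integrable_def by (subst (asm) integrable_completion) auto
  then have "set_integrable lborel {\<delta>..} (\<lambda>x. B * x powr (- c - 1))" by simp
  then show ?thesis
  proof (rule set_integrable_bound)
    show "set_borel_measurable lborel {\<delta>..} (\<lambda>x. x powr (- c) * v x / x)"
      unfolding set_borel_measurable_def by measurable
    show "AE x in lborel. x \<in> {\<delta>..} \<longrightarrow> norm (x powr (- c) * v x / x) \<le> norm (B * x powr (- c - 1))"
    proof (intro AE_I2 impI)
      fix x :: real assume "x \<in> {\<delta>..}"
      then have "0 < x" using \<open>0 < \<delta>\<close> by simp
      have "x powr (- c - 1) = x powr (- c) / x" using \<open>0 < x\<close> by (simp add: powr_diff)
      moreover have "0 \<le> B" using order_trans[OF assms(2,3)] .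
      moreover have "x powr (- c) / x * v x \<le> x powr (- c) / x * B"
        using \<open>0 < x\<close> assms(3) by (intro mult_left_mono) auto
      ultimately show "norm (x powr (- c) * v x / x) \<le> norm (B * x powr (- c - 1))"
        using \<open>0 < x\<close> assms(2)[of x] by (simp add: abs_mult mult_ac)
    qed
  qed
qed

text \<open>
  After the substitution \<open>x = exp (- t)\<close> this is the antiderivative \<open>W t\<close> of
  \<open>Z t = exp (c * t) * v (exp (- t))\<close> that vanishes at minus infinity (for bounded \<open>v\<close>), with \<open>\<delta> = exp (- t)\<close>.
\<close>

definition tail_integral :: "real \<Rightarrow> (real \<Rightarrow> real) \<Rightarrow> real \<Rightarrow> real" where
  "tail_integral c v \<delta> = (LBINT x:{\<delta>..}. x powr (- c) * v x / x)"

lemma tail_integral_scale: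
  assumes "0 < \<rho>" "0 < \<delta>"
  shows "tail_integral c (\<lambda>x. v (x / \<rho>)) \<delta> = \<rho> powr (- c) * tail_integral c v (\<delta> / \<rho>)"
proof -
  have "tail_integral c (\<lambda>x. v (x / \<rho>)) \<delta>
      = \<rho> * (LINT x|lborel. indicator {\<delta>..} (0 + \<rho> * x) *\<^sub>R ((0 + \<rho> * x) powr (- c) * v ((0 + \<rho> * x) / \<rho>) / (0 + \<rho> * x)))"
    unfolding tail_integral_def set_lebesgue_integral_def
    using \<open>0 < \<rho>\<close> by (subst lborel_integral_real_affine[of \<rho> _ 0]) auto
  also have "\<dots> = \<rho> * (LINT x|lborel. \<rho> powr (- c) / \<rho> * (indicator {\<delta> / \<rho>..} x *\<^sub>R (x powr (- c) * v x / x)))"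
  proof (intro arg_cong2[where f="(*)"] refl Bochner_Integration.integral_cong)
    fix x :: real
    show "indicator {\<delta>..} (0 + \<rho> * x) *\<^sub>R ((0 + \<rho> * x) powr (- c) * v ((0 + \<rho> * x) / \<rho>) / (0 + \<rho> * x))
        = \<rho> powr (- c) / \<rho> * (indicator {\<delta> / \<rho>..} x *\<^sub>R (x powr (- c) * v x / x))"
    proof (cases "\<delta> / \<rho> \<le> x")
      case True
      then have "0 < x" "\<delta> \<le> \<rho> * x"
        using assms divide_pos_pos[of \<delta> \<rho>] by (linarith, simp add: field_simps)
      then show ?thesis using True \<open>0 < \<rho>\<close> by (simp add: powr_mult)
    next
      case False
      then have "\<not> \<delta> \<le> \<rho> * x" using assms by (simp add: field_simps)
      then show ?thesis using False by simp
    qed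
  qed
  also have "\<dots> = \<rho> powr (- c) * tail_integral c v (\<delta> / \<rho>)"
    unfolding tail_integral_def set_lebesgue_integral_def
    by (subst integral_mult_right_zero) (use \<open>0 < \<rho>\<close> in simp)
  finally show ?thesis .
qed

context
  fixes v :: "real \<Rightarrow> real" and B c :: real
  assumes v: "mono v" "\<And>x. 0 \<le> v x" "\<And>x. v x \<le> B" and c: "0 < c"
begin

lemma has_integral_tail_integral:
  assumes "0 < \<delta>"
  shows "((\<lambda>x. x powr (- c) * v x / x) has_integral tail_integral c v \<delta>) {\<delta>..}"
  using set_borel_integral_eq_integral[OF set_integrable_powr_tail[OF v c assms]]
  by (simp add: tail_integral_def integrable_integral)

lemma has_integral_tail_integral_diff:
  assumes "0 < \<alpha>" "\<alpha> \<le> \<beta>"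
  shows "((\<lambda>x. x powr (- c) * v x / x) has_integral (tail_integral c v \<alpha> - tail_integral c v \<beta>)) {\<alpha>..\<beta>}"
proof -
  have "set_integrable lborel {\<alpha>..\<beta>} (\<lambda>x. x powr (- c) * v x / x)"
    using set_integrable_powr_tail[OF v c \<open>0 < \<alpha>\<close>] by (rule set_integrable_subset) auto
  then have "(\<lambda>x. x powr (- c) * v x / x) integrable_on {\<alpha>..\<beta>}"
    by (rule set_borel_integral_eq_integral)
  then obtain y where y: "((\<lambda>x. x powr (- c) * v x / x) has_integral y) {\<alpha>..\<beta>}"
    by (auto simp: integrable_on_def)
  have "{\<alpha>..\<beta>} \<inter> {\<beta>..} = {\<beta>}" "{\<alpha>..\<beta>} \<union> {\<beta>..} = {\<alpha>..}" using assms by auto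
  then have "((\<lambda>x. x powr (- c) * v x / x) has_integral (y + tail_integral c v \<beta>)) {\<alpha>..}"
    using has_integral_Un[OF y has_integral_tail_integral[of \<beta>]] assms by simp
  then have "tail_integral c v \<alpha> = y + tail_integral c v \<beta>"
    by (rule has_integral_unique[OF has_integral_tail_integral[OF \<open>0 < \<alpha>\<close>]])
  then show ?thesis using y by simp
qed

lemma set_integral_eq_tail_integral_diff:
  assumes "0 < \<alpha>" "\<alpha> \<le> \<beta>"
  shows "(LBINT x:{\<alpha>..\<beta>}. x powr (- c) * v x / x) = tail_integral c v \<alpha> - tail_integral c v \<beta>"
proof -
  have "set_integrable lborel {\<alpha>..\<beta>} (\<lambda>x. x powr (- c) * v x / x)"
    using set_integrable_powr_tail[OF v c \<open>0 < \<alpha>\<close>] by (rule set_integrable_subset) auto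
  from set_borel_integral_eq_integral(2)[OF this] integral_unique[OF has_integral_tail_integral_diff[OF assms]]
  show ?thesis by (rule trans)
qed

lemma tail_integral_diff_bounds:
  assumes "0 < \<alpha>" "\<alpha> \<le> \<beta>"
  shows "(\<And>x. \<alpha> \<le> x \<Longrightarrow> x \<le> \<beta> \<Longrightarrow> b \<le> x powr (- c) * v x) \<Longrightarrow>
      b * (ln \<beta> - ln \<alpha>) \<le> tail_integral c v \<alpha> - tail_integral c v \<beta>"
    and "(\<And>x. \<alpha> \<le> x \<Longrightarrow> x \<le> \<beta> \<Longrightarrow> x powr (- c) * v x \<le> b) \<Longrightarrow>
      tail_integral c v \<alpha> - tail_integral c v \<beta> \<le> b * (ln \<beta> - ln \<alpha>)"
proof -
  have "(ln has_vector_derivative 1 / x) (at x within {\<alpha>..\<beta>})" if "x \<in> {\<alpha>..\<beta>}" for x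
    using that assms DERIV_ln_divide[of x]
    by (simp add: has_field_derivative_at_within flip: has_real_derivative_iff_has_vector_derivative)
  then have "((\<lambda>x. b * (1 / x)) has_integral b * (ln \<beta> - ln \<alpha>)) {\<alpha>..\<beta>}"
    using assms by (intro has_integral_mult_right fundamental_theorem_of_calculus) auto
  note b = this and w = has_integral_tail_integral_diff[OF assms]
  show "b * (ln \<beta> - ln \<alpha>) \<le> tail_integral c v \<alpha> - tail_integral c v \<beta>"
    if "\<And>x. \<alpha> \<le> x \<Longrightarrow> x \<le> \<beta> \<Longrightarrow> b \<le> x powr (- c) * v x"
  proof (rule has_integral_le[OF b w])
    fix x assume "x \<in> {\<alpha>..\<beta>}"
    then show "b * (1 / x) \<le> x powr (- c) * v x / x"
      using that[of x] assms divide_right_mono[of b _ x] by simp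
  qed
  show "tail_integral c v \<alpha> - tail_integral c v \<beta> \<le> b * (ln \<beta> - ln \<alpha>)"
    if "\<And>x. \<alpha> \<le> x \<Longrightarrow> x \<le> \<beta> \<Longrightarrow> x powr (- c) * v x \<le> b"
  proof (rule has_integral_le[OF w b])
    fix x assume "x \<in> {\<alpha>..\<beta>}"
    then show "x powr (- c) * v x / x \<le> b * (1 / x)"
      using that[of x] assms divide_right_mono[of _ b x] by simp
  qed
qed

end

text \<open>
  The renewal theorems, transported from \<open>t\<close> to \<open>x = exp (- t)\<close>. Monotonicity of \<open>v\<close> yields the slow
  growth of \<open>exp (c * t) * v (exp (- t))\<close>, and integrating the scaling equation against
  \<open>x powr (- c - 1)\<close> over \<open>{\<delta>..}\<close> yields the conserved quantity, the tail integral of \<open>f\<close>.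
\<close>

theorem scaling_renewal:
  fixes v f :: "real \<Rightarrow> real" and q \<rho> :: "'i \<Rightarrow> real"
  assumes "finite I" "I \<noteq> {}" and c: "0 < c"
    and \<rho>: "\<And>i. i \<in> I \<Longrightarrow> 0 < \<rho> i \<and> \<rho> i < 1" and q: "\<And>i. i \<in> I \<Longrightarrow> 0 < q i"
    and balance: "(\<Sum>i\<in>I. q i * \<rho> i powr (- c)) = 1"
    and v: "mono v" "\<And>x. 0 \<le> v x" "\<And>x. v x \<le> B"
    and f: "mono f" "\<And>x. 0 \<le> f x" "\<And>x. f x \<le> B'"
    and scaling: "\<And>x. 0 < x \<Longrightarrow> v x = f x + (\<Sum>i\<in>I. q i * v (x / \<rho> i))"
    and f0: "((\<lambda>x. x powr (- c) * f x) \<longlongrightarrow> 0) (at_right 0)"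
    and J: "(tail_integral c f \<longlongrightarrow> J) (at_right 0)"
  defines "\<eta> \<equiv> - (\<Sum>i\<in>I. q i * \<rho> i powr (- c) * ln (\<rho> i))"
  shows "((\<lambda>\<delta>. 1 / \<bar>ln \<delta>\<bar> * (LBINT x:{\<delta>..1}. x powr (- c) * v x / x)) \<longlongrightarrow> J / \<eta>) (at_right 0)"
    and "\<not> discrete (group_closure ((\<lambda>i. ln (\<rho> i)) ` I)) \<Longrightarrow>
      ((\<lambda>x. x powr (- c) * v x) \<longlongrightarrow> J / \<eta>) (at_right 0)"
proof -
  define p a where "p i = q i * \<rho> i powr (- c)" and "a i = - ln (\<rho> i)" for i
  have "0 < q i * \<rho> i powr (- c)" if "i \<in> I" for i
    using \<rho>[OF that] q[OF that] by simp
  then interpret step_distribution I p a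
    using assms(1,2) \<rho> balance
    by unfold_locales (auto simp: p_def a_def)
  have mean: "mean = \<eta>"
    by (simp add: mean_def \<eta>_def p_def a_def sum_negf)
  define Z where "Z t = exp (- t) powr (- c) * v (exp (- t))" for t
  define h where "h t = exp (- t) powr (- c) * f (exp (- t))" for t
  define W where "W t = tail_integral c v (exp (- t))" for t
  have exp_a: "exp (- (t - a i)) = exp (- t) / \<rho> i" if "i \<in> I" for t i
    using \<rho>[OF that] by (simp add: a_def exp_diff exp_minus field_simps exp_add)
  have ren: "Z t = h t + (\<Sum>i\<in>I. p i * Z (t - a i))" for t
  proof -
    have "Z t = h t + (\<Sum>i\<in>I. exp (- t) powr (- c) * (q i * v (exp (- t) / \<rho> i)))"
      by (simp add: Z_def h_def scaling distrib_left sum_distrib_left)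
    moreover have "exp (- t) powr (- c) * (q i * v (exp (- t) / \<rho> i)) = p i * Z (t - a i)" if "i \<in> I" for i
      unfolding Z_def exp_a[OF that] p_def using \<rho>[OF that] by (simp add: powr_divide)
    ultimately show ?thesis by simp
  qed
  have exp0: "filterlim (\<lambda>t :: real. exp (- t)) (at_right 0) at_top"
    by real_asymp
  have h: "(h \<longlongrightarrow> 0) at_top"
    unfolding h_def using filterlim_compose[OF f0 exp0] by simp
  have W_ren: "(\<Sum>i\<in>I. p i * (W t - W (t - a i))) = tail_integral c f (exp (- t))" for t
  proof -
    define \<delta> where "\<delta> = exp (- t)"
    have "0 < \<delta>" by (simp add: \<delta>_def)
    have int: "((\<lambda>x. x powr (- c) * v (x / \<rho> i) / x) has_integral tail_integral c (\<lambda>x. v (x / \<rho> i)) \<delta>) {\<delta>..}"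
      if "i \<in> I" for i
      using v \<rho>[OF that] \<open>0 < \<delta>\<close> c
      by (intro has_integral_tail_integral[of _ B]) (auto simp: mono_def divide_right_mono)
    have "((\<lambda>x. x powr (- c) * f x / x + (\<Sum>i\<in>I. q i * (x powr (- c) * v (x / \<rho> i) / x)))
      has_integral tail_integral c f \<delta> + (\<Sum>i\<in>I. q i * tail_integral c (\<lambda>x. v (x / \<rho> i)) \<delta>)) {\<delta>..}"
      using int \<open>finite I\<close> has_integral_tail_integral[OF f c \<open>0 < \<delta>\<close>]
      by (intro has_integral_add has_integral_sum has_integral_mult_right) auto
    moreover have "x powr (- c) * f x / x + (\<Sum>i\<in>I. q i * (x powr (- c) * v (x / \<rho> i) / x))
        = x powr (- c) * v x / x" if "x \<in> {\<delta>..}" for x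
    proof -
      have "0 < x" using that \<open>0 < \<delta>\<close> by simp
      then show ?thesis
        by (simp add: scaling[of x] distrib_left add_divide_distrib sum_distrib_left sum_divide_distrib mult_ac)
    qed
    ultimately have "((\<lambda>x. x powr (- c) * v x / x)
      has_integral tail_integral c f \<delta> + (\<Sum>i\<in>I. q i * tail_integral c (\<lambda>x. v (x / \<rho> i)) \<delta>)) {\<delta>..}"
      by (rule has_integral_eq[rotated])
    then have "tail_integral c v \<delta> = tail_integral c f \<delta> + (\<Sum>i\<in>I. q i * tail_integral c (\<lambda>x. v (x / \<rho> i)) \<delta>)"
      by (rule has_integral_unique[OF has_integral_tail_integral[OF v c \<open>0 < \<delta>\<close>]])
    also have "(\<Sum>i\<in>I. q i * tail_integral c (\<lambda>x. v (x / \<rho> i)) \<delta>) = (\<Sum>i\<in>I. p i * W (t - a i))"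
    proof (rule sum.cong)
      fix i assume "i \<in> I"
      then show "q i * tail_integral c (\<lambda>x. v (x / \<rho> i)) \<delta> = p i * W (t - a i)"
        unfolding W_def exp_a[OF \<open>i \<in> I\<close>] p_def \<delta>_def
        using \<rho> by (simp add: tail_integral_scale)
    qed simp
    finally have "W t = tail_integral c f \<delta> + (\<Sum>i\<in>I. p i * W (t - a i))"
      by (simp add: W_def \<delta>_def)
    moreover have "(\<Sum>i\<in>I. p i * W t) = W t" using p_sum by (simp flip: sum_distrib_right)
    ultimately show ?thesis by (simp add: right_diff_distrib sum_subtractf \<delta>_def)
  qed
  have lim: "((\<lambda>t. \<Sum>i\<in>I. p i * (W t - W (t - a i))) \<longlongrightarrow> J) at_top"
    unfolding W_ren using filterlim_compose[OF J exp0] .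
  have nonneg: "0 \<le> Z t" for t by (simp add: Z_def v(2))
  have lower: "b * (t - s) \<le> W t - W s"
    if "s \<le> t" and b: "\<And>u. s \<le> u \<Longrightarrow> u \<le> t \<Longrightarrow> b \<le> Z u" for s t b
  proof -
    have "b \<le> x powr (- c) * v x" if x: "exp (- t) \<le> x" "x \<le> exp (- s)" for x
    proof -
      have "0 < x" using x(1) by (rule less_le_trans[rotated]) simp
      then have "- t \<le> ln x" "ln x \<le> - s"
        using x ln_le_cancel_iff[of x "exp (- s)"] by (simp_all add: ln_ge_iff)
      then show ?thesis using b[of "- ln x"] \<open>0 < x\<close> by (simp add: Z_def)
    qed
    then show ?thesis
      using tail_integral_diff_bounds(1)[OF v c, of "exp (- t)" "exp (- s)" b] \<open>s \<le> t\<close> by (simp add: W_def)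
  qed
  have upper: "W t - W s \<le> b * (t - s)"
    if "s \<le> t" and b: "\<And>u. s \<le> u \<Longrightarrow> u \<le> t \<Longrightarrow> Z u \<le> b" for s t b
  proof -
    have "x powr (- c) * v x \<le> b" if x: "exp (- t) \<le> x" "x \<le> exp (- s)" for x
    proof -
      have "0 < x" using x(1) by (rule less_le_trans[rotated]) simp
      then have "- t \<le> ln x" "ln x \<le> - s"
        using x ln_le_cancel_iff[of x "exp (- s)"] by (simp_all add: ln_ge_iff)
      then show ?thesis using b[of "- ln x"] \<open>0 < x\<close> by (simp add: Z_def)
    qed
    then show ?thesis
      using tail_integral_diff_bounds(2)[OF v c, of "exp (- t)" "exp (- s)" b] \<open>s \<le> t\<close> by (simp add: W_def)
  qed
  have slow: "Z (t + u) \<le> exp (c * u) * Z t" if "0 \<le> u" for t u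
  proof -
    have "v (exp (- (t + u))) \<le> v (exp (- t))" using v(1) that by (simp add: monoD)
    then have "exp (c * (t + u)) * v (exp (- (t + u))) \<le> exp (c * (t + u)) * v (exp (- t))" by simp
    then show ?thesis by (simp add: Z_def powr_def exp_add algebra_simps)
  qed
  have ln0: "filterlim (\<lambda>x :: real. - ln x) at_top (at_right 0)" by real_asymp
  show "((\<lambda>x. x powr (- c) * v x) \<longlongrightarrow> J / \<eta>) (at_right 0)"
    if "\<not> discrete (group_closure ((\<lambda>i. ln (\<rho> i)) ` I))"
  proof -
    have "a ` I = uminus ` (\<lambda>i. ln (\<rho> i)) ` I" by (simp add: image_image a_def)
    then have "\<not> discrete (group_closure (a ` I))" using that by (simp add: group_closure_uminus_image)
    with nonneg slow c ren h lower upper lim have "(Z \<longlongrightarrow> J / mean) at_top"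
      by (rule renewal_nonlattice[where Z = Z and h = h and W = W and J = J and c = c])
    then have "(Z \<longlongrightarrow> J / \<eta>) at_top" by (simp only: mean)
    from filterlim_compose[OF this ln0] show ?thesis
      by (rule Lim_transform_eventually)
        (rule eventually_mono[OF eventually_at_right_less], simp add: Z_def)
  qed
  show "((\<lambda>\<delta>. 1 / \<bar>ln \<delta>\<bar> * (LBINT x:{\<delta>..1}. x powr (- c) * v x / x)) \<longlongrightarrow> J / \<eta>) (at_right 0)"
  proof -
    have "mono W" using lower[of _ _ 0] nonneg by (simp add: mono_def)
    then have "((\<lambda>t. W t / t) \<longlongrightarrow> J / \<eta>) at_top"
      using renewal_average[OF _ lim] by (simp add: mean)
    moreover have "((\<lambda>t. W 0 / t) \<longlongrightarrow> 0) at_top"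
      by (rule tendsto_divide_0[OF tendsto_const filterlim_at_top_imp_at_infinity[OF filterlim_ident]])
    ultimately have "((\<lambda>t. W t / t - W 0 / t) \<longlongrightarrow> J / \<eta> - 0) at_top" by (rule tendsto_diff)
    from filterlim_compose[OF this ln0]
    have "((\<lambda>\<delta>. W (- ln \<delta>) / (- ln \<delta>) - W 0 / (- ln \<delta>)) \<longlongrightarrow> J / \<eta>) (at_right 0)"
      by (simp only: diff_0_right)
    moreover have "\<forall>\<^sub>F \<delta> in at_right 0. W (- ln \<delta>) / (- ln \<delta>) - W 0 / (- ln \<delta>)
        = 1 / \<bar>ln \<delta>\<bar> * (LBINT x:{\<delta>..1}. x powr (- c) * v x / x)"
      using eventually_at_right_real[of 0 1]
    proof (rule eventually_mono)
      fix \<delta> :: real assume "\<delta> \<in> {0<..<1}"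
      then show "W (- ln \<delta>) / (- ln \<delta>) - W 0 / (- ln \<delta>)
        = 1 / \<bar>ln \<delta>\<bar> * (LBINT x:{\<delta>..1}. x powr (- c) * v x / x)"
        by (simp add: set_integral_eq_tail_integral_diff[OF v c] W_def diff_divide_distrib)
    qed simp
    ultimately show ?thesis by (rule Lim_transform_eventually)
  qed
qed

section \<open>Inner parallel volumes\<close>

lemma lmeasurable_inner_parallel_set:
  assumes "open U" "bounded U"
  shows "{x\<in>U. infdist x (frontier U) \<le> \<epsilon>} \<in> lmeasurable"
proof -
  have "closed {x. infdist x (frontier U) \<le> \<epsilon>}"
    by (intro closed_Collect_le continuous_intros)
  then have "U \<inter> {x. infdist x (frontier U) \<le> \<epsilon>} \<in> sets borel"
    using assms by auto
  then show ?thesis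
    using bounded_subset[OF \<open>bounded U\<close>] by (intro bounded_set_imp_lmeasurable) (auto simp: Int_def)
qed

lemma inner_parallel_volume_nonneg: "0 \<le> inner_parallel_volume U \<epsilon>"
  by (simp add: inner_parallel_volume_def)

lemma inner_parallel_volume_le_measure:
  assumes "open U" "bounded U"
  shows "inner_parallel_volume U \<epsilon> \<le> measure lebesgue U"
  unfolding inner_parallel_volume_def
  using assms lmeasurable_inner_parallel_set[OF assms]
  by (intro measure_mono_fmeasurable) (auto simp: lmeasurable_open fmeasurableD)

lemma mono_inner_parallel_volume:
  assumes "open U" "bounded U"
  shows "mono (inner_parallel_volume U)"
  unfolding inner_parallel_volume_def
  using lmeasurable_inner_parallel_set[OF assms]
  by (intro monoI measure_mono_fmeasurable) (auto simp: fmeasurableD)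

text \<open>
  A frontier point of \<open>A\<close> cannot lie in \<open>B\<close>, since \<open>B\<close> is open and misses \<open>A\<close>.
\<close>

lemma frontier_subset_frontier_open_piece:
  assumes "open A" "open B" "A \<inter> B = {}"
  shows "frontier A \<subseteq> frontier (A \<union> B)"
proof
  fix y assume y: "y \<in> frontier A"
  then have "y \<notin> A" "y \<in> closure A" using assms(1) by (auto simp: frontier_def interior_open)
  moreover have "y \<notin> B"
    using \<open>y \<in> closure A\<close> open_Int_closure_eq_empty[OF assms(2), of A] assms(3) by blast
  ultimately show "y \<in> frontier (A \<union> B)"
    using assms(1,2) by (auto simp: frontier_def interior_open open_Un)
qed

text \<open>
  The segment from a point of \<open>A\<close> to a nearest frontier point of the union has to leave \<open>A\<close>, so it
  meets the frontier of \<open>A\<close> at a point that is not farther away. Boundedness guarantees that the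
  frontiers are nonempty.
\<close>

lemma infdist_frontier_open_piece:
  fixes A B :: "'a::euclidean_space set"
  assumes "open A" "open B" "A \<inter> B = {}" "bounded A" "bounded B" and x: "x \<in> A"
  shows "infdist x (frontier (A \<union> B)) = infdist x (frontier A)"
proof (rule antisym)
  have ne: "frontier A \<noteq> {}" "frontier (A \<union> B) \<noteq> {}"
    using x assms(4,5) not_bounded_UNIV by (metis empty_iff frontier_not_empty bounded_Un UnI1)+
  show "infdist x (frontier (A \<union> B)) \<le> infdist x (frontier A)"
    by (rule infdist_mono[OF frontier_subset_frontier_open_piece[OF assms(1-3)] ne(1)])
  obtain z where z: "z \<in> frontier (A \<union> B)" "infdist x (frontier (A \<union> B)) = dist x z"
    using infdist_attains_inf[OF frontier_closed ne(2)] by blast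
  have "z \<notin> A" using z assms(1,2) by (auto simp: frontier_def interior_open open_Un)
  then have "closed_segment x z \<inter> frontier A \<noteq> {}"
    using x by (intro connected_Int_frontier) auto
  then obtain y where y: "y \<in> closed_segment x z" "y \<in> frontier A" by blast
  have "infdist x (frontier A) \<le> dist x y" using y by (simp add: infdist_le)
  also have "\<dots> \<le> dist x z" using y dist_in_closed_segment[OF y(1)] by (simp add: dist_commute)
  finally show "infdist x (frontier A) \<le> infdist x (frontier (A \<union> B))" using z by simp
qed

lemma inner_parallel_volume_Un:
  fixes A B :: "'a::euclidean_space set"
  assumes "open A" "open B" "A \<inter> B = {}" "bounded A" "bounded B"
  shows "inner_parallel_volume (A \<union> B) \<epsilon> = inner_parallel_volume A \<epsilon> + inner_parallel_volume B \<epsilon>"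
proof -
  have "{x\<in>A \<union> B. infdist x (frontier (A \<union> B)) \<le> \<epsilon>}
      = {x\<in>A. infdist x (frontier A) \<le> \<epsilon>} \<union> {x\<in>B. infdist x (frontier B) \<le> \<epsilon>}"
    using infdist_frontier_open_piece[OF assms] infdist_frontier_open_piece[OF assms(2,1) _ assms(5,4)] assms(3)
    by (auto simp: Un_commute Int_commute)
  moreover have "{x\<in>A. infdist x (frontier A) \<le> \<epsilon>} \<inter> {x\<in>B. infdist x (frontier B) \<le> \<epsilon>} = {}"
    using assms(3) by blast
  ultimately show ?thesis
    unfolding inner_parallel_volume_def
    using lmeasurable_inner_parallel_set[OF assms(1,4), of \<epsilon>] lmeasurable_inner_parallel_set[OF assms(2,5), of \<epsilon>]
    by (simp only: measure_Un3 measure_empty diff_0_right)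
qed

lemma inner_parallel_volume_empty [simp]: "inner_parallel_volume {} \<epsilon> = 0"
  by (simp add: inner_parallel_volume_def)

lemma inner_parallel_volume_UN:
  fixes A :: "'i \<Rightarrow> 'a::euclidean_space set"
  assumes "finite I" "\<And>i. i \<in> I \<Longrightarrow> open (A i)" "\<And>i. i \<in> I \<Longrightarrow> bounded (A i)"
    "\<And>i j. i \<in> I \<Longrightarrow> j \<in> I \<Longrightarrow> i \<noteq> j \<Longrightarrow> A i \<inter> A j = {}"
  shows "inner_parallel_volume (\<Union>i\<in>I. A i) \<epsilon> = (\<Sum>i\<in>I. inner_parallel_volume (A i) \<epsilon>)"
  using assms
proof (induction I)
  case (insert j I)
  have "inner_parallel_volume (A j \<union> (\<Union>i\<in>I. A i)) \<epsilon>
      = inner_parallel_volume (A j) \<epsilon> + inner_parallel_volume (\<Union>i\<in>I. A i) \<epsilon>"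
    using insert.hyps insert.prems by (intro inner_parallel_volume_Un open_UN bounded_UN) (auto, blast)
  then show ?case using insert by simp
qed simp

lemma infdist_frontier_le_inradius:
  assumes "bounded G" "x \<in> G"
  shows "infdist x (frontier G) \<le> inradius G"
  unfolding inradius_def
proof (rule cSUP_upper[OF \<open>x \<in> G\<close>])
  have "compact ((\<lambda>x. infdist x (frontier G)) ` closure G)"
    using assms by (intro compact_continuous_image continuous_intros) auto
  then show "bdd_above ((\<lambda>x. infdist x (frontier G)) ` G)"
    using bounded_subset[OF compact_imp_bounded] closure_subset by (metis bounded_imp_bdd_above image_mono)
qed

lemma inradius_pos:
  fixes G :: "'a::euclidean_space set"
  assumes "open G" "bounded G" "G \<noteq> {}"
  shows "0 < inradius G"
proof -
  obtain x where "x \<in> G" using assms by blast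
  moreover have "frontier G \<noteq> {}" using assms not_bounded_UNIV by (metis frontier_not_empty)
  moreover have "x \<notin> frontier G" using \<open>x \<in> G\<close> assms(1) by (simp add: frontier_def interior_open)
  ultimately have "0 < infdist x (frontier G)" by (simp add: infdist_pos_not_in_closed)
  then show ?thesis using infdist_frontier_le_inradius[OF assms(2) \<open>x \<in> G\<close>] by simp
qed

lemma inner_parallel_volume_ge_inradius:
  assumes "bounded G" "inradius G \<le> \<epsilon>"
  shows "inner_parallel_volume G \<epsilon> = measure lebesgue G"
proof -
  have "{x\<in>G. infdist x (frontier G) \<le> \<epsilon>} = G"
    using infdist_frontier_le_inradius[OF assms(1)] assms(2) by force
  then show ?thesis by (simp add: inner_parallel_volume_def)
qed

section \<open>Similarities\<close>

text \<open>
  After translation and rescaling a similarity is an isometry that fixes the origin, hence linear.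
  This serves to prove that similarities are surjective.
\<close>

lemma similarity_orthogonal_transformation:
  fixes f :: "'a::euclidean_space \<Rightarrow> 'a"
  assumes "0 < \<rho>" and sim: "\<And>x y. dist (f x) (f y) = \<rho> * dist x y"
  obtains T where "orthogonal_transformation T" "\<And>x. f x = f 0 + \<rho> *\<^sub>R T x"
proof
  show "orthogonal_transformation (\<lambda>x. (1 / \<rho>) *\<^sub>R (f x - f 0))"
    unfolding orthogonal_transformation_isometry
    using assms by (auto simp: dist_norm simp flip: scaleR_diff_right)
  show "f x = f 0 + \<rho> *\<^sub>R ((1 / \<rho>) *\<^sub>R (f x - f 0))" for x
    using \<open>0 < \<rho>\<close> by simp
qed

lemma similarity_surj:
  fixes f :: "'a::euclidean_space \<Rightarrow> 'a"
  assumes "0 < \<rho>" and sim: "\<And>x y. dist (f x) (f y) = \<rho> * dist x y"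
  shows "surj f"
proof -
  obtain T where T: "orthogonal_transformation T" "\<And>x. f x = f 0 + \<rho> *\<^sub>R T x"
    by (rule similarity_orthogonal_transformation[OF assms]) (rule that)
  have "\<exists>x. y = f x" for y
  proof -
    obtain x where "T x = (1 / \<rho>) *\<^sub>R (y - f 0)"
      using orthogonal_transformation_surj[OF T(1)] by (metis surjD)
    then have "y = f x" using T(2)[of x] \<open>0 < \<rho>\<close> by simp
    then show ?thesis ..
  qed
  then show ?thesis by (simp add: surj_def)
qed

lemma similarity_inj:
  assumes "0 < \<rho>" and sim: "\<And>x y. dist (f x) (f y) = \<rho> * dist x y"
  shows "inj f"
  using assms by (metis dist_eq_0_iff injI mult_eq_0_iff less_irrefl)

lemma similarity_image_ball:
  fixes f :: "'a::euclidean_space \<Rightarrow> 'a"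
  assumes "0 < \<rho>" and sim: "\<And>x y. dist (f x) (f y) = \<rho> * dist x y"
  shows "f ` ball x s = ball (f x) (\<rho> * s)"
proof (intro set_eqI iffI)
  fix y assume "y \<in> ball (f x) (\<rho> * s)"
  moreover obtain z where "y = f z" using similarity_surj[OF assms] by (metis surjD)
  ultimately show "y \<in> f ` ball x s" using assms by auto
qed (use assms in auto)

lemma similarity_homeomorphism:
  fixes f :: "'a::euclidean_space \<Rightarrow> 'a"
  assumes "0 < \<rho>" and sim: "\<And>x y. dist (f x) (f y) = \<rho> * dist x y"
  shows "homeomorphism UNIV UNIV f (inv f)"
proof -
  have bij: "bij f" using similarity_inj[OF assms] similarity_surj[OF assms] by (simp add: bij_def)
  have "\<rho>-lipschitz_on UNIV f" using assms by (intro lipschitz_onI) auto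
  moreover have "dist (inv f x) (inv f y) = 1 / \<rho> * dist x y" for x y
    using sim[of "inv f x" "inv f y"] \<open>0 < \<rho>\<close> bij by (simp add: surj_f_inv_f bij_is_surj field_simps)
  then have "(1 / \<rho>)-lipschitz_on UNIV (inv f)" using \<open>0 < \<rho>\<close> by (intro lipschitz_onI) auto
  ultimately show ?thesis
    using bij by (auto simp: homeomorphism_def lipschitz_on_continuous_on bij_is_surj bij_is_inj surj_f_inv_f
        bij_imp_bij_inv)
qed

lemma similarity_open_image:
  fixes f :: "'a::euclidean_space \<Rightarrow> 'a"
  assumes "0 < \<rho>" and sim: "\<And>x y. dist (f x) (f y) = \<rho> * dist x y" and "open A"
  shows "open (f ` A)"
  using homeomorphism_imp_open_map[OF similarity_homeomorphism[OF assms(1,2)], of A] \<open>open A\<close>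
  by simp

lemma similarity_bounded_image:
  assumes sim: "\<And>x y. dist (f x) (f y) = \<rho> * dist x y" and "bounded A"
  shows "bounded (f ` A)"
proof -
  obtain y R where "\<forall>x\<in>A. dist y x \<le> R" using \<open>bounded A\<close> by (auto simp: bounded_def)
  then have "\<forall>x\<in>A. dist (f y) (f x) \<le> \<bar>\<rho>\<bar> * R"
    unfolding sim by (intro ballI mult_mono) auto
  then show ?thesis by (auto simp: bounded_def)
qed

lemma similarity_frontier_image:
  fixes f :: "'a::euclidean_space \<Rightarrow> 'a"
  assumes "0 < \<rho>" and sim: "\<And>x y. dist (f x) (f y) = \<rho> * dist x y"
  shows "frontier (f ` A) = f ` frontier A"
proof -
  have ball_diff: "ball (f x) (\<rho> * e) - f ` A = f ` (ball x e - A)" for x e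
    using similarity_image_ball[OF assms] similarity_inj[OF assms] by (simp add: image_set_diff)
  have ball_int: "ball (f x) (\<rho> * e) \<inter> f ` A = f ` (ball x e \<inter> A)" for x e
    using similarity_image_ball[OF assms] similarity_inj[OF assms] by (simp add: image_Int)
  have fr: "x \<in> frontier B \<longleftrightarrow> (\<forall>e>0. ball x e \<inter> B \<noteq> {} \<and> ball x e - B \<noteq> {})" for x and B :: "'a set"
    unfolding frontier_straddle by (simp add: set_eq_iff Bex_def conj_commute)
  have scale: "(\<forall>e>0. P e) \<longleftrightarrow> (\<forall>e>0. P (\<rho> * e))" for P
  proof (intro iffI allI impI)
    fix e :: real assume P: "\<forall>e>0. P (\<rho> * e)" and "0 < e"
    then have "P (\<rho> * (e / \<rho>))" using \<open>0 < \<rho>\<close> by (intro P[rule_format]) simp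
    then show "P e" using \<open>0 < \<rho>\<close> by simp
  qed (use \<open>0 < \<rho>\<close> in auto)
  have "f x \<in> frontier (f ` A) \<longleftrightarrow> x \<in> frontier A" for x
    unfolding fr by (subst scale) (simp only: ball_diff ball_int image_is_empty)
  note iff = this
  show ?thesis
  proof (intro set_eqI iffI)
    fix y assume y: "y \<in> frontier (f ` A)"
    obtain x where "y = f x" using similarity_surj[OF assms] by (metis surjD)
    then show "y \<in> f ` frontier A" using y iff by blast
  qed (use iff in auto)
qed

lemma similarity_infdist_image:
  assumes "0 < \<rho>" and sim: "\<And>x y. dist (f x) (f y) = \<rho> * dist x y"
  shows "infdist (f x) (f ` A) = \<rho> * infdist x A"
proof (cases "A = {}")
  case False
  show ?thesis
  proof (rule antisym)
    have "infdist (f x) (f ` A) / \<rho> \<le> infdist x A"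
      unfolding infdist_notempty[OF False]
    proof (rule cINF_greatest[OF False])
      fix a assume "a \<in> A"
      then show "infdist (f x) (f ` A) / \<rho> \<le> dist x a"
        using infdist_le[of "f a" "f ` A" "f x"] assms by (simp add: field_simps)
    qed
    then show "infdist (f x) (f ` A) \<le> \<rho> * infdist x A" using \<open>0 < \<rho>\<close> by (simp add: field_simps)
    have "f ` A \<noteq> {}" using False by simp
    then show "\<rho> * infdist x A \<le> infdist (f x) (f ` A)"
      unfolding infdist_notempty[OF \<open>f ` A \<noteq> {}\<close>]
      using assms by (intro cINF_greatest) (auto simp: infdist_le)
  qed
qed (simp add: infdist_def)

text \<open>
  By Vitali's covering theorem an open set is, up to a null set, a countable disjoint union of
  balls. A similarity maps balls to balls with the radius multiplied by \<open>\<rho>\<close>, and, being Lipschitz,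
  null sets to null sets.
\<close>

lemma similarity_measure_open_image:
  fixes f :: "'a::euclidean_space \<Rightarrow> 'a"
  assumes "0 < \<rho>" and sim: "\<And>x y. dist (f x) (f y) = \<rho> * dist x y" and "open A"
  shows "measure lebesgue (f ` A) = \<rho> ^ DIM('a) * measure lebesgue A"
proof -
  define K where "K = {(x, s). 0 < s \<and> ball x s \<subseteq> A}"
  have "\<exists>i. i \<in> K \<and> x \<in> ball (fst i) (snd i) \<and> snd i < d" if "x \<in> A" "0 < d" for x d
  proof -
    obtain e where "0 < e" "ball x e \<subseteq> A" using \<open>open A\<close> \<open>x \<in> A\<close> openE by blast
    then have "(x, min e (d / 2)) \<in> K"
      using \<open>0 < d\<close> subset_ball[of "min e (d / 2)" e x] unfolding K_def by simp
    then show ?thesis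
      using \<open>0 < d\<close> \<open>0 < e\<close> by (intro exI[of _ "(x, min e (d / 2))"]) simp
  qed
  note cover = this
  obtain C where C: "countable C" "C \<subseteq> K"
    "pairwise (\<lambda>i j. disjnt (ball (fst i) (snd i)) (ball (fst j) (snd j))) C"
    "negligible (A - (\<Union>i\<in>C. ball (fst i) (snd i)))"
    using Vitali_covering_theorem_balls[of A K fst snd, OF cover] .
  define B where "B = (\<lambda>i :: 'a \<times> real. ball (fst i) (snd i))"
  have "B i \<subseteq> A" if "i \<in> C" for i
    using C(2) that by (cases i) (auto simp: K_def B_def)
  then have BA: "(\<Union>i\<in>C. B i) \<subseteq> A" by blast
  have fB: "f ` B i = ball (f (fst i)) (\<rho> * snd i)" for i
    unfolding B_def by (rule similarity_image_ball[OF assms(1,2)])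
  have disj: "disjoint_family_on B C"
    using C(3) by (auto simp: disjoint_family_on_def pairwise_def disjnt_def B_def)
  then have fdisj: "disjoint_family_on (\<lambda>i. f ` B i) C"
    using similarity_inj[OF assms(1,2)]
    by (auto simp: disjoint_family_on_def simp flip: image_Int)
  have neg: "negligible (f ` (A - (\<Union>i\<in>C. B i)))"
  proof (rule negligible_locally_Lipschitz_image)
    show "negligible (A - (\<Union>i\<in>C. B i))" using C(4) by (simp add: B_def)
    show "\<exists>T L. open T \<and> x \<in> T \<and> (\<forall>y\<in>(A - \<Union> (B ` C)) \<inter> T. norm (f y - f x) \<le> L * norm (y - x))" for x
      using sim by (intro exI[of _ UNIV] exI[of _ \<rho>]) (auto simp: dist_norm)
  qed simp
  have e1: "emeasure lebesgue A = (\<integral>\<^sup>+i. emeasure lebesgue (B i) \<partial>count_space C)"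
  proof -
    have "emeasure lebesgue A = emeasure lebesgue ((\<Union>i\<in>C. B i) \<union> (A - (\<Union>i\<in>C. B i)))"
      using BA by (simp add: Un_absorb1)
    also have "\<dots> = emeasure lebesgue (\<Union>i\<in>C. B i)"
      using C(1,4) by (intro emeasure_Un_null_set) (auto simp: B_def negligible_iff_null_sets)
    also have "\<dots> = (\<integral>\<^sup>+i. emeasure lebesgue (B i) \<partial>count_space C)"
      using C(1) disj by (intro emeasure_UN_countable) (auto simp: B_def)
    finally show ?thesis .
  qed
  have e2: "emeasure lebesgue (f ` A) = (\<integral>\<^sup>+i. emeasure lebesgue (f ` B i) \<partial>count_space C)"
  proof -
    have "f ` A = (\<Union>i\<in>C. f ` B i) \<union> f ` (A - (\<Union>i\<in>C. B i))"
      using BA by blast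
    then have "emeasure lebesgue (f ` A) = emeasure lebesgue ((\<Union>i\<in>C. f ` B i) \<union> f ` (A - (\<Union>i\<in>C. B i)))"
      by simp
    also have "\<dots> = emeasure lebesgue (\<Union>i\<in>C. f ` B i)"
      using C(1) neg by (intro emeasure_Un_null_set) (auto simp: fB negligible_iff_null_sets)
    also have "\<dots> = (\<integral>\<^sup>+i. emeasure lebesgue (f ` B i) \<partial>count_space C)"
      using C(1) fdisj by (intro emeasure_UN_countable) (auto simp: fB)
    finally show ?thesis .
  qed
  have "emeasure lebesgue (f ` B i) = ennreal (\<rho> ^ DIM('a)) * emeasure lebesgue (B i)" if "i \<in> C" for i
  proof -
    have "0 < snd i" using that C(2) by (auto simp: K_def)
    then have "emeasure lebesgue (B i) = ennreal (snd i ^ DIM('a)) * emeasure lebesgue (ball (0::'a) 1)"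
      "emeasure lebesgue (f ` B i) = ennreal ((\<rho> * snd i) ^ DIM('a)) * emeasure lebesgue (ball (0::'a) 1)"
      unfolding fB unfolding B_def using \<open>0 < \<rho>\<close>
      by (intro emeasure_lebesgue_ball_conv_unit_ball; simp)+
    then show ?thesis
      using \<open>0 < \<rho>\<close> \<open>0 < snd i\<close> by (simp only: power_mult_distrib ennreal_mult zero_le_power less_imp_le mult.assoc)
  qed
  then have "emeasure lebesgue (f ` A) = (\<integral>\<^sup>+i. ennreal (\<rho> ^ DIM('a)) * emeasure lebesgue (B i) \<partial>count_space C)"
    unfolding e2 by (intro nn_integral_cong) auto
  also have "\<dots> = ennreal (\<rho> ^ DIM('a)) * emeasure lebesgue A"
    unfolding e1 by (intro nn_integral_cmult) auto
  finally show ?thesis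
    unfolding measure_def using \<open>0 < \<rho>\<close> by (simp only: enn2real_mult enn2real_ennreal zero_le_power less_imp_le)
qed

text \<open>
  A compact set is the difference of two bounded open sets: a ball, and the ball without it.
\<close>

lemma similarity_measure_compact_image:
  fixes f :: "'a::euclidean_space \<Rightarrow> 'a"
  assumes "0 < \<rho>" and sim: "\<And>x y. dist (f x) (f y) = \<rho> * dist x y" and "compact K"
  shows "measure lebesgue (f ` K) = \<rho> ^ DIM('a) * measure lebesgue K"
proof -
  obtain R where R: "K \<subseteq> ball 0 R"
    using bounded_subset_ballD[OF compact_imp_bounded[OF \<open>compact K\<close>]] by blast
  have op: "open (ball (0::'a) R)" "open (ball 0 R - K)"
    using \<open>compact K\<close> by (auto simp: compact_imp_closed open_Diff)
  have "f ` K = f ` ball 0 R - f ` (ball 0 R - K)"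
    using R similarity_inj[OF assms(1,2)] by (auto simp: inj_def)
  moreover have "f ` ball 0 R \<in> lmeasurable" "f ` (ball 0 R - K) \<in> lmeasurable"
    using op similarity_open_image[OF assms(1,2)]
    by (auto intro!: lmeasurable_open similarity_bounded_image[OF sim] bounded_diff)
  ultimately have "measure lebesgue (f ` K) = measure lebesgue (f ` ball 0 R) - measure lebesgue (f ` (ball 0 R - K))"
    by (simp only: measurable_measure_Diff fmeasurableD image_mono Diff_subset)
  also have "\<dots> = \<rho> ^ DIM('a) * (measure lebesgue (ball (0::'a) R) - measure lebesgue (ball 0 R - K))"
    by (simp only: similarity_measure_open_image[OF assms(1,2) op(1)]
        similarity_measure_open_image[OF assms(1,2) op(2)] right_diff_distrib)
  also have "measure lebesgue (ball 0 R - K) = measure lebesgue (ball (0::'a) R) - measure lebesgue K"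
    using R \<open>compact K\<close> by (intro measurable_measure_Diff) (auto simp: lmeasurable_compact fmeasurableD)
  finally show ?thesis by simp
qed

text \<open>
  The inner parallel set is the difference of two open sets, \<open>A\<close> and the set of points of \<open>A\<close> at
  distance more than \<open>\<epsilon>\<close> from the frontier, so \<open>similarity_measure_open_image\<close> suffices.
\<close>

lemma similarity_inner_parallel_volume:
  fixes f :: "'a::euclidean_space \<Rightarrow> 'a"
  assumes "0 < \<rho>" and sim: "\<And>x y. dist (f x) (f y) = \<rho> * dist x y" and A: "open A" "bounded A"
  shows "inner_parallel_volume (f ` A) \<epsilon> = \<rho> ^ DIM('a) * inner_parallel_volume A (\<epsilon> / \<rho>)"
proof -
  have split: "inner_parallel_volume B \<epsilon>
      = measure lebesgue B - measure lebesgue {x\<in>B. \<epsilon> < infdist x (frontier B)}"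
    if "open B" "bounded B" for B :: "'a set" and \<epsilon>
  proof -
    have "open {x. \<epsilon> < infdist x (frontier B)}" by (intro open_Collect_less continuous_intros)
    then have "{x\<in>B. \<epsilon> < infdist x (frontier B)} \<in> lmeasurable"
      using that bounded_subset[OF \<open>bounded B\<close>]
      by (intro lmeasurable_open) (auto simp: Collect_conj_eq)
    moreover have "{x\<in>B. infdist x (frontier B) \<le> \<epsilon>} = B - {x\<in>B. \<epsilon> < infdist x (frontier B)}" by auto
    ultimately show ?thesis
      unfolding inner_parallel_volume_def using that
      by (simp add: measurable_measure_Diff fmeasurableD lmeasurable_open del: measure_completion)
  qed
  have op: "open {x\<in>A. \<epsilon> / \<rho> < infdist x (frontier A)}"
  proof -
    have "open {x. \<epsilon> / \<rho> < infdist x (frontier A)}" by (intro open_Collect_less continuous_intros)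
    then show ?thesis using \<open>open A\<close> by (auto simp: Collect_conj_eq)
  qed
  have "infdist (f x) (frontier (f ` A)) = \<rho> * infdist x (frontier A)" for x
    by (simp add: similarity_frontier_image[OF assms(1,2)] similarity_infdist_image[OF assms(1,2)])
  then have "{y\<in>f ` A. \<epsilon> < infdist y (frontier (f ` A))} = f ` {x\<in>A. \<epsilon> / \<rho> < infdist x (frontier A)}"
    using \<open>0 < \<rho>\<close> by (auto simp: field_simps)
  then show ?thesis
    using split[OF similarity_open_image[OF assms(1,2) A(1)] similarity_bounded_image[OF sim A(2)]]
      split[OF A] similarity_measure_open_image[OF assms(1,2) A(1)]
      similarity_measure_open_image[OF assms(1,2) op]
    by (simp add: right_diff_distrib del: measure_completion)
qed

section \<open>The integral of a monophase profile\<close>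

lemma powr_tendsto_0_at_right: "0 < a \<Longrightarrow> ((\<lambda>x::real. x powr a) \<longlongrightarrow> 0) (at_right 0)"
  by real_asymp

lemma powr_mult_polynomial:
  assumes "0 < (x::real)"
  shows "x powr (D - real d) * (\<Sum>k<d. \<kappa> k * x ^ (d - k)) = (\<Sum>k<d. \<kappa> k * x powr (D - real k))"
proof -
  have "x powr (D - real d) * (\<kappa> k * x ^ (d - k)) = \<kappa> k * x powr (D - real k)" if "k < d" for k
    using that assms by (simp add: of_nat_diff algebra_simps flip: powr_realpow powr_add)
  then show ?thesis unfolding sum_distrib_left by (intro sum.cong) auto
qed

lemma tendsto_monophase_profile:
  fixes f :: "real \<Rightarrow> real"
  assumes f: "\<And>x. 0 < x \<Longrightarrow> x \<le> g \<Longrightarrow> f x = (\<Sum>k<d. \<kappa> k * x ^ (d - k))"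
    and "0 < g" "real d - 1 < D"
  shows "((\<lambda>x. x powr (- (real d - D)) * f x) \<longlongrightarrow> 0) (at_right 0)"
proof -
  have "((\<lambda>x. \<Sum>k<d. \<kappa> k * x powr (D - real k)) \<longlongrightarrow> (\<Sum>k<d. \<kappa> k * 0)) (at_right 0)"
    using \<open>real d - 1 < D\<close> by (intro tendsto_intros powr_tendsto_0_at_right) auto
  moreover have "\<forall>\<^sub>F x in at_right 0. (\<Sum>k<d. \<kappa> k * x powr (D - real k)) = x powr (- (real d - D)) * f x"
    using eventually_at_right_real[OF \<open>0 < g\<close>]
    by eventually_elim (simp add: f powr_mult_polynomial)
  ultimately show ?thesis by (simp add: Lim_transform_eventually)
qed

text \<open>
  The integral is split at \<open>g\<close>. Below \<open>g\<close> the integrand is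
  \<open>\<Sum>k. \<kappa> k * x powr (D - k - 1)\<close>, above it is a multiple of \<open>x powr (- c - 1)\<close> with
  \<open>c = d - D\<close>. The two contributions of the index \<open>k\<close> are combined by
  \<open>1 / (D - k) + 1 / (d - D) = (d - k) / ((D - k) * (d - D))\<close>.
\<close>

lemma tendsto_tail_integral_monophase:
  fixes f :: "real \<Rightarrow> real"
  assumes f: "\<And>x. 0 < x \<Longrightarrow> x \<le> g \<Longrightarrow> f x = (\<Sum>k<d. \<kappa> k * x ^ (d - k))"
    and const: "\<And>x. g \<le> x \<Longrightarrow> f x = f g"
    and "0 < g" "real d - 1 < D" "D < real d"
    and mono: "mono f" "\<And>x. 0 \<le> f x" "\<And>x. f x \<le> B"
  shows "(tail_integral (real d - D) f \<longlongrightarrow>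
    1 / (real d - D) * (\<Sum>k<d. (real d - real k) / (D - real k) * \<kappa> k * g powr (D - real k))) (at_right 0)"
proof -
  define c where "c = real d - D"
  have "0 < c" using assms by (simp add: c_def)
  have tail: "tail_integral c f \<delta> =
      (\<Sum>k<d. \<kappa> k * (g powr (D - real k) / (D - real k) - \<delta> powr (D - real k) / (D - real k))) + f g * (g powr (- c) / c)"
    if \<delta>: "0 < \<delta>" "\<delta> \<le> g" for \<delta>
  proof -
    have "((\<lambda>x. \<Sum>k<d. \<kappa> k * x powr (D - real k - 1)) has_integral
      (\<Sum>k<d. \<kappa> k * (g powr (D - real k) / (D - real k) - \<delta> powr (D - real k) / (D - real k)))) {\<delta>..g}"
      using \<delta> \<open>real d - 1 < D\<close>
      by (intro has_integral_sum has_integral_mult_right fundamental_theorem_of_calculus)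
        (auto intro!: derivative_eq_intros simp flip: has_real_derivative_iff_has_vector_derivative)
    then have 1: "((\<lambda>x. x powr (- c) * f x / x) has_integral
      (\<Sum>k<d. \<kappa> k * (g powr (D - real k) / (D - real k) - \<delta> powr (D - real k) / (D - real k)))) {\<delta>..g}"
    proof (rule has_integral_eq[rotated])
      fix x assume "x \<in> {\<delta>..g}"
      then have "0 < x" "x \<le> g" using \<delta> by auto
      then have "x powr (- c) * f x = (\<Sum>k<d. \<kappa> k * x powr (D - real k))"
        using powr_mult_polynomial[OF \<open>0 < x\<close>, of D d \<kappa>] by (simp add: f c_def)
      then show "(\<Sum>k<d. \<kappa> k * x powr (D - real k - 1)) = x powr (- c) * f x / x"
        using \<open>0 < x\<close> by (simp add: sum_divide_distrib powr_diff)
    qed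
    have "((\<lambda>x. f g * x powr (- c - 1)) has_integral f g * (- (g powr (- c - 1 + 1)) / (- c - 1 + 1))) {g..}"
      using \<open>0 < c\<close> \<open>0 < g\<close> by (intro has_integral_mult_right has_integral_powr_to_inf) auto
    then have "((\<lambda>x. f g * x powr (- c - 1)) has_integral f g * (g powr (- c) / c)) {g..}" by simp
    then have 2: "((\<lambda>x. x powr (- c) * f x / x) has_integral f g * (g powr (- c) / c)) {g..}"
    proof (rule has_integral_eq[rotated])
      fix x assume "x \<in> {g..}"
      then show "f g * x powr (- c - 1) = x powr (- c) * f x / x"
        using \<open>0 < g\<close> const[of x] by (simp add: powr_diff)
    qed
    have "{\<delta>..g} \<inter> {g..} = {g}" "{\<delta>..g} \<union> {g..} = {\<delta>..}" using \<delta> by auto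
    then have "((\<lambda>x. x powr (- c) * f x / x) has_integral
        (\<Sum>k<d. \<kappa> k * (g powr (D - real k) / (D - real k) - \<delta> powr (D - real k) / (D - real k))) + f g * (g powr (- c) / c)) {\<delta>..}"
      using has_integral_Un[OF 1 2] by simp
    then show ?thesis
      by (intro has_integral_unique[OF has_integral_tail_integral[OF mono \<open>0 < c\<close> \<delta>(1)]]) simp
  qed
  have fg: "f g * (g powr (- c) / c) = (\<Sum>k<d. \<kappa> k * (g powr (D - real k) / c))"
  proof -
    have "g powr (- c) * f g = (\<Sum>k<d. \<kappa> k * g powr (D - real k))"
      using \<open>0 < g\<close> powr_mult_polynomial[of g D d \<kappa>] by (simp add: f c_def)
    then have "f g * (g powr (- c) / c) = (\<Sum>k<d. \<kappa> k * g powr (D - real k)) / c" by (simp add: mult.commute)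
    then show ?thesis by (simp add: sum_divide_distrib)
  qed
  have "((\<lambda>\<delta>. (\<Sum>k<d. \<kappa> k * (g powr (D - real k) / (D - real k) - \<delta> powr (D - real k) / (D - real k))) + f g * (g powr (- c) / c))
    \<longlongrightarrow> (\<Sum>k<d. \<kappa> k * (g powr (D - real k) / (D - real k) - 0 / (D - real k))) + f g * (g powr (- c) / c)) (at_right 0)"
    using \<open>real d - 1 < D\<close> by (intro tendsto_intros powr_tendsto_0_at_right) auto
  moreover have "\<forall>\<^sub>F \<delta> in at_right 0. (\<Sum>k<d. \<kappa> k * (g powr (D - real k) / (D - real k) - \<delta> powr (D - real k) / (D - real k)))
      + f g * (g powr (- c) / c) = tail_integral c f \<delta>"
    using eventually_at_right_real[OF \<open>0 < g\<close>] by eventually_elim (simp add: tail)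
  ultimately have "(tail_integral c f \<longlongrightarrow>
     (\<Sum>k<d. \<kappa> k * (g powr (D - real k) / (D - real k) - 0 / (D - real k))) + f g * (g powr (- c) / c)) (at_right 0)"
    by (rule Lim_transform_eventually)
  also have "(\<Sum>k<d. \<kappa> k * (g powr (D - real k) / (D - real k) - 0 / (D - real k))) + f g * (g powr (- c) / c)
      = (\<Sum>k<d. \<kappa> k * (g powr (D - real k) / (D - real k) + g powr (D - real k) / c))"
    unfolding fg by (simp add: sum.distrib distrib_left)
  also have "\<dots> = 1 / c * (\<Sum>k<d. (real d - real k) / (D - real k) * \<kappa> k * g powr (D - real k))"
    unfolding sum_distrib_left
  proof (rule sum.cong)
    fix k assume "k \<in> {..<d}"
    then have "D - real k \<noteq> 0" using \<open>real d - 1 < D\<close> by auto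
    then show "\<kappa> k * (g powr (D - real k) / (D - real k) + g powr (D - real k) / c)
      = 1 / c * ((real d - real k) / (D - real k) * \<kappa> k * g powr (D - real k))"
      using \<open>0 < c\<close> by (simp add: divide_simps) (simp add: c_def algebra_simps)
  qed simp
  finally show ?thesis by (simp add: c_def)
qed

section \<open>Self-similar tilings\<close>

lemma word_map_Nil [simp]: "word_map S [] = id"
  by (simp add: word_map_def)

lemma word_map_Cons [simp]: "word_map S (i # w) = S i \<circ> word_map S w"
  by (simp add: word_map_def)

locale self_similar_tiling =
  fixes N :: nat and r :: "nat \<Rightarrow> real" and S :: "nat \<Rightarrow> 'a::euclidean_space \<Rightarrow> 'a" and U :: "'a set"
  assumes ifs: "similarity_ifs N r S" and feasible: "feasible_open N S U"
begin

abbreviation "G \<equiv> tiling_generator N S U"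
abbreviation "T \<equiv> \<Union>(tiling N S U)"

lemma ratio: "i \<in> {1..N} \<Longrightarrow> 0 < r i" "i \<in> {1..N} \<Longrightarrow> r i < 1"
  and sim: "i \<in> {1..N} \<Longrightarrow> dist (S i x) (S i y) = r i * dist x y"
  and N_ge_2: "2 \<le> N"
  using ifs by (auto simp: similarity_ifs_def)

lemma U_open: "open U" and U_bounded: "bounded U" and U_nonempty: "U \<noteq> {}"
  and S_U: "i \<in> {1..N} \<Longrightarrow> S i ` U \<subseteq> U"
  and S_disjoint: "i \<in> {1..N} \<Longrightarrow> j \<in> {1..N} \<Longrightarrow> i \<noteq> j \<Longrightarrow> S i ` U \<inter> S j ` U = {}"
  using feasible by (auto simp: feasible_open_def)

lemma sum_ratio_powr_dim: "(\<Sum>i=1..N. r i powr similarity_dim N r) = 1"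
  unfolding similarity_dim_def
  using theI'[OF similarity_dim_ex1[of N r]] N_ge_2 ratio by blast

lemma compact_S_closure:
  assumes "i \<in> {1..N}"
  shows "compact (S i ` closure U)"
proof (rule compact_continuous_image)
  have "(r i)-lipschitz_on (closure U) (S i)"
    using sim[OF assms] ratio[OF assms] by (intro lipschitz_onI) auto
  then show "continuous_on (closure U) (S i)" by (rule lipschitz_on_continuous_on)
qed (simp add: U_bounded)

lemma G_subset: "G \<subseteq> U"
  by (auto simp: tiling_generator_def)

lemma G_open: "open G"
  unfolding tiling_generator_def ifs_image_def
  using U_open compact_S_closure by (intro open_Diff closed_UN) (auto intro: compact_imp_closed)

lemma G_bounded: "bounded G"
  using G_subset U_bounded bounded_subset by blast

text \<open>
  Otherwise \<open>closure U\<close> is covered by its own images under the \<open>S i\<close>, whose total volume is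
  \<open>\<Sum>i. r i ^ d < \<Sum>i. r i powr D = 1\<close> times its volume; but this volume is positive and finite.
\<close>

lemma G_nonempty:
  assumes "similarity_dim N r < real DIM('a)"
  shows "G \<noteq> {}"
proof
  assume "G = {}"
  then have "U \<subseteq> (\<Union>i\<in>{1..N}. S i ` closure U)"
    by (auto simp: tiling_generator_def ifs_image_def)
  moreover have "closed (\<Union>i\<in>{1..N}. S i ` closure U)"
    using compact_S_closure by (intro closed_UN) (auto intro: compact_imp_closed)
  ultimately have "closure U \<subseteq> (\<Union>i\<in>{1..N}. S i ` closure U)" by (rule closure_minimal)
  moreover have m: "S i ` closure U \<in> lmeasurable" if "i \<in> {1..N}" for i
    using compact_S_closure[OF that] by (rule lmeasurable_compact)
  ultimately have "measure lebesgue (closure U) \<le> measure lebesgue (\<Union>i\<in>{1..N}. S i ` closure U)"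
    by (intro measure_mono_fmeasurable fmeasurable.finite_UN) (auto simp: U_bounded)
  also have "\<dots> \<le> (\<Sum>i=1..N. measure lebesgue (S i ` closure U))"
    using m by (intro measure_UNION_le) (auto simp: fmeasurableD)
  also have "\<dots> = (\<Sum>i=1..N. r i ^ DIM('a)) * measure lebesgue (closure U)"
    unfolding sum_distrib_right using ratio sim
    by (intro sum.cong similarity_measure_compact_image) (auto simp: U_bounded)
  finally have le: "measure lebesgue (closure U) \<le> (\<Sum>i=1..N. r i ^ DIM('a)) * measure lebesgue (closure U)" .
  have "(\<Sum>i=1..N. r i ^ DIM('a)) < (\<Sum>i=1..N. r i powr similarity_dim N r)"
  proof (rule sum_strict_mono)
    fix i assume i: "i \<in> {1..N}"
    show "r i ^ DIM('a) < r i powr similarity_dim N r"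
      using powr_less_mono'[OF ratio[OF i] assms] ratio(1)[OF i] by (simp only: powr_realpow)
  qed (use N_ge_2 in auto)
  then have "(\<Sum>i=1..N. r i ^ DIM('a)) < 1" by (simp only: sum_ratio_powr_dim)
  moreover have "0 < measure lebesgue (closure U)"
  proof -
    obtain x e where "0 < e" "ball x e \<subseteq> U" using U_nonempty U_open openE by (metis ex_in_conv)
    then have "measure lebesgue (ball x e) \<le> measure lebesgue (closure U)"
      using closure_subset[of U] by (intro measure_mono_fmeasurable) (auto simp: U_bounded lmeasurable_compact)
    moreover have "0 < measure lebesgue (ball x e)" using content_ball_pos[OF \<open>0 < e\<close>, of x] by simp
    ultimately show ?thesis by linarith
  qed
  ultimately have "(\<Sum>i=1..N. r i ^ DIM('a)) * measure lebesgue (closure U) < 1 * measure lebesgue (closure U)"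
    by (intro mult_strict_right_mono)
  then show False using le by linarith
qed

lemma word_map_image:
  assumes "set w \<subseteq> {1..N}"
  shows "word_map S w ` G \<subseteq> U" "open (word_map S w ` G)"
proof -
  have "word_map S w ` G \<subseteq> U \<and> open (word_map S w ` G)" using assms
  proof (induction w)
    case Nil
    then show ?case using G_subset G_open by simp
  next
    case (Cons i w)
    then have i: "i \<in> {1..N}" and w: "word_map S w ` G \<subseteq> U" "open (word_map S w ` G)" by auto
    have eq: "word_map S (i # w) ` G = S i ` (word_map S w ` G)" by (simp add: image_comp)
    have "S i ` (word_map S w ` G) \<subseteq> U" using w(1) S_U[OF i] by blast
    then show ?case
      unfolding eq using similarity_open_image[OF ratio(1)[OF i] sim[OF i] w(2)] by blast
  qed
  then show "word_map S w ` G \<subseteq> U" "open (word_map S w ` G)" by auto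
qed

lemma T_eq_UN: "T = (\<Union>w\<in>{w. set w \<subseteq> {1..N}}. word_map S w ` G)"
  by (auto simp: tiling_def)

lemma T_open: "open T" and T_subset: "T \<subseteq> U"
  unfolding T_eq_UN using word_map_image by (auto intro!: open_UN)

lemma T_bounded: "bounded T"
  using T_subset U_bounded bounded_subset by blast

text \<open>
  A word is empty or begins with a letter.
\<close>

lemma T_decomposition: "T = G \<union> (\<Union>i\<in>{1..N}. S i ` T)"
proof -
  have "{w. set w \<subseteq> {1..N}} = insert [] (\<Union>i\<in>{1..N}. (#) i ` {w. set w \<subseteq> {1..N}})"
  proof (intro set_eqI iffI)
    fix w assume "w \<in> {w. set w \<subseteq> {1..N}}"
    then show "w \<in> insert [] (\<Union>i\<in>{1..N}. (#) i ` {w. set w \<subseteq> {1..N}})" by (cases w) auto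
  qed auto
  note words = this
  define F where "F w = word_map S w ` G" for w
  have F_Nil: "F [] = G" and F_Cons: "F (i # w) = S i ` F w" for i w
    by (simp_all add: F_def image_comp)
  have T_eq: "T = (\<Union>w\<in>{w. set w \<subseteq> {1..N}}. F w)"
    unfolding F_def by (rule T_eq_UN)
  also have "\<dots> = (\<Union>w\<in>insert [] (\<Union>i\<in>{1..N}. (#) i ` {w. set w \<subseteq> {1..N}}). F w)"
    by (rule arg_cong[OF words])
  also have "\<dots> = F [] \<union> (\<Union>i\<in>{1..N}. \<Union>w\<in>{w. set w \<subseteq> {1..N}}. F (i # w))"
    by blast
  also have "\<dots> = G \<union> (\<Union>i\<in>{1..N}. S i ` (\<Union>w\<in>{w. set w \<subseteq> {1..N}}. F w))"
    by (simp only: F_Nil F_Cons image_UN)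
  finally show ?thesis by (simp only: T_eq)
qed

text \<open>
  The pieces are disjoint: \<open>S i ` T\<close> lies in \<open>S i ` U\<close>, which \<open>G\<close> avoids by construction and
  which is disjoint from the other images by the open set condition.
\<close>

lemma inner_parallel_volume_T:
  "inner_parallel_volume T \<epsilon> = inner_parallel_volume G \<epsilon> + (\<Sum>i=1..N. r i ^ DIM('a) * inner_parallel_volume T (\<epsilon> / r i))"
proof -
  have op: "open (S i ` T)" and bd: "bounded (S i ` T)"
    and vol: "inner_parallel_volume (S i ` T) \<epsilon> = r i ^ DIM('a) * inner_parallel_volume T (\<epsilon> / r i)"
    if "i \<in> {1..N}" for i
    using similarity_open_image[OF ratio(1)[OF that] sim[OF that] T_open]
      similarity_bounded_image[OF sim[OF that] T_bounded]
      similarity_inner_parallel_volume[OF ratio(1)[OF that] sim[OF that] T_open T_bounded] by auto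
  have "S i ` T \<subseteq> S i ` U" for i using T_subset by blast
  then have disj: "S i ` T \<inter> S j ` T = {}" if "i \<in> {1..N}" "j \<in> {1..N}" "i \<noteq> j" for i j
    using S_disjoint[OF that] by blast
  have G_disjoint: "G \<inter> (\<Union>i\<in>{1..N}. S i ` T) = {}"
    using T_subset closure_subset[of U] unfolding tiling_generator_def ifs_image_def by blast
  have "inner_parallel_volume T \<epsilon> = inner_parallel_volume (G \<union> (\<Union>i\<in>{1..N}. S i ` T)) \<epsilon>"
    by (rule arg_cong[OF T_decomposition])
  also have "\<dots> = inner_parallel_volume G \<epsilon> + inner_parallel_volume (\<Union>i\<in>{1..N}. S i ` T) \<epsilon>"
    using op bd G_disjoint by (intro inner_parallel_volume_Un G_open G_bounded open_UN bounded_UN) auto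
  also have "inner_parallel_volume (\<Union>i\<in>{1..N}. S i ` T) \<epsilon> = (\<Sum>i=1..N. inner_parallel_volume (S i ` T) \<epsilon>)"
    using op bd disj by (intro inner_parallel_volume_UN) auto
  also have "\<dots> = (\<Sum>i=1..N. r i ^ DIM('a) * inner_parallel_volume T (\<epsilon> / r i))"
    by (rule sum.cong[OF refl vol])
  finally show ?thesis .
qed

end

section \<open>Minkowski contents of monophase tilings\<close>

theorem corollary3p8:
  fixes S :: "nat \<Rightarrow> 'a::euclidean_space \<Rightarrow> 'a"
    and U :: "'a set" and N :: nat and r \<kappa> :: "nat \<Rightarrow> real"
    and D g \<eta> \<Gamma> :: real and G :: "'a set"
  defines "D \<equiv> similarity_dim N r"
    and "G \<equiv> tiling_generator N S U"
    and "g \<equiv> inradius G"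
    and "\<eta> \<equiv> - (\<Sum>i=1..N. r i powr D * ln (r i))"
    and "\<Gamma> \<equiv> (\<Sum>k<DIM('a). (real DIM('a) - real k) / (D - real k) * \<kappa> k * g powr (D - real k))"
  assumes "similarity_ifs N r S"
    and "feasible_open N S U"
    and "D < real DIM('a)"
    and "D > real DIM('a) - 1"
    and "monophase_with G \<kappa>"
  shows "has_average_minkowski_content D (tiling N S U) (1 / \<eta> * (1 / (real DIM('a) - D)) * \<Gamma>) \<and>
     (nonlattice N r \<longrightarrow>
       has_minkowski_content D (tiling N S U) (1 / \<eta> * (1 / (real DIM('a) - D)) * \<Gamma>))"
proof -
  interpret self_similar_tiling N r S U
    using assms by unfold_locales
  define c where "c = real DIM('a) - D"
  have G: "open G" "bounded G" "G \<noteq> {}"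
    unfolding G_def using G_open G_bounded G_nonempty assms(8) by (auto simp: D_def)
  have "0 < g" unfolding g_def by (rule inradius_pos[OF G])
  have f: "inner_parallel_volume G x = (\<Sum>k<DIM('a). \<kappa> k * x ^ (DIM('a) - k))" if "0 < x" "x \<le> g" for x
    using \<open>monophase_with G \<kappa>\<close> that by (auto simp: monophase_with_def g_def)
  have const: "inner_parallel_volume G x = inner_parallel_volume G g" if "g \<le> x" for x
    using that inner_parallel_volume_ge_inradius[OF \<open>bounded G\<close>] by (simp add: g_def)
  have weight: "r i ^ DIM('a) * r i powr (- c) = r i powr D" if "i \<in> {1..N}" for i
    using ratio[OF that] by (simp add: c_def flip: powr_realpow powr_add)
  have J: "(tail_integral c (inner_parallel_volume G) \<longlongrightarrow> 1 / c * \<Gamma>) (at_right 0)"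
    unfolding c_def \<Gamma>_def
    using f const \<open>0 < g\<close> assms(9,8) mono_inner_parallel_volume[OF G(1,2)] inner_parallel_volume_nonneg
      inner_parallel_volume_le_measure[OF G(1,2)]
    by (rule tendsto_tail_integral_monophase[where f = "inner_parallel_volume G"])
  have f0: "((\<lambda>x. x powr (- c) * inner_parallel_volume G x) \<longlongrightarrow> 0) (at_right 0)"
    unfolding c_def using f \<open>0 < g\<close> assms(9) by (rule tendsto_monophase_profile[where f = "inner_parallel_volume G"])
  have balance: "(\<Sum>i=1..N. r i ^ DIM('a) * r i powr (- c)) = 1"
    using sum_ratio_powr_dim by (simp add: weight flip: D_def)
  have "0 < c" using assms(8) by (simp add: c_def)
  have ends: "1 / c * \<Gamma> / - (\<Sum>i=1..N. r i ^ DIM('a) * r i powr (- c) * ln (r i))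
      = 1 / \<eta> * (1 / (real DIM('a) - D)) * \<Gamma>"
  proof -
    have "(\<Sum>i=1..N. r i ^ DIM('a) * r i powr (- c) * ln (r i)) = (\<Sum>i=1..N. r i powr D * ln (r i))"
      by (intro sum.cong refl) (simp only: weight)
    then show ?thesis unfolding \<eta>_def c_def by simp
  qed
  have scaling: "inner_parallel_volume T x
      = inner_parallel_volume G x + (\<Sum>i=1..N. r i ^ DIM('a) * inner_parallel_volume T (x / r i))" for x
    unfolding G_def by (rule inner_parallel_volume_T)
  note renewal = scaling_renewal[where I = "{1..N}" and q = "\<lambda>i. r i ^ DIM('a)" and \<rho> = r
      and v = "inner_parallel_volume T" and f = "inner_parallel_volume G" and c = c and J = "1 / c * \<Gamma>",
      OF _ _ \<open>0 < c\<close> _ _ balance mono_inner_parallel_volume[OF T_open T_bounded]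
      inner_parallel_volume_nonneg inner_parallel_volume_le_measure[OF T_open T_bounded]
      mono_inner_parallel_volume[OF G(1,2)] inner_parallel_volume_nonneg
      inner_parallel_volume_le_measure[OF G(1,2)] scaling f0 J, unfolded ends]
  have c': "D - real DIM('a) = - c" by (simp add: c_def)
  have "has_average_minkowski_content D (tiling N S U) (1 / \<eta> * (1 / (real DIM('a) - D)) * \<Gamma>)"
    unfolding has_average_minkowski_content_def c'
    by (rule renewal(1)) (use N_ge_2 ratio in auto)
  moreover have "has_minkowski_content D (tiling N S U) (1 / \<eta> * (1 / (real DIM('a) - D)) * \<Gamma>)"
    if "nonlattice N r"
    unfolding has_minkowski_content_def c'
    by (rule renewal(2)) (use N_ge_2 ratio that in \<open>auto simp: nonlattice_def\<close>)
  ultimately show ?thesis by blast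
qed

end
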